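(* Let $A\subset\mathbb{Z}^2$ be a finite nonempty set, let $N:=|\operatorname{enc}(A)\setminus A|$ and $E:=\operatorname{Exc}(\operatorname{enc}(A))$. Then the following are equivalent: (1) $A$ is minimal; (2) $|\partial A|=|\partial(\operatorname{enc}(A))|$ and $N\le E$; (3) $\mathbb{Z}^2\setminus A$ is a union of cones and $N\le E$.
   Context: $X$ is the graph with vertex set $\mathbb{Z}^2$ in which $(x,y)$ and $(x',y')$ are adjacent iff $|x-x'|+|y-y'|=1$. For $A\subset\mathbb{Z}^2$, the vertex boundary is $\partial A=\{u\in\mathbb{Z}^2\setminus A:\ u \text{ is adjacent to some } v\in A\}$. A finite set $A$ is minimal if $|\partial A|\le|\partial C|$ for every $C\subset\mathbb{Z}^2$ with $|C|=|A|$. Two sets are congruent if some graph automorphism of $X$ maps one onto the other. For integers $a,b,c,d$ let $B(a,b,c,d)=\{(x,y)\in\mathbb{Z}^2: a\le y-x\le b,\ c\le y+x\le d\}$; a box is a nonempty set of this form. The enclosing box $\operatorname{enc}(A)$ of a finite nonempty set $A$ is the smallest box containing $A$. The excess of a finite set $A$ is $\operatorname{Exc}(A)=\max\{|A|-|C|:\ C\subset\mathbb{Z}^2 \text{ minimal},\ |\partial C|=|\partial A|\}$. A cone is a subset of $\mathbb{Z}^2$ congruent to $\{(x,y): y-x\ge0,\ y+x\ge0\}$. *)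

theory Defs
  imports Main
begin

definition adj :: "int \<times> int \<Rightarrow> int \<times> int \<Rightarrow> bool" where
  "adj p q \<longleftrightarrow> \<bar>fst p - fst q\<bar> + \<bar>snd p - snd q\<bar> = 1"

definition vboundary :: "(int \<times> int) set \<Rightarrow> (int \<times> int) set" where
  "vboundary A = {u. u \<notin> A \<and> (\<exists>v\<in>A. adj u v)}"

text \<open>The competitor has to be required finite: infinite sets have \<^term>\<open>card\<close> equal to 0.\<close>

definition minimal :: "(int \<times> int) set \<Rightarrow> bool" where
  "minimal A \<longleftrightarrow> finite A \<and>
     (\<forall>C. finite C \<and> card C = card A \<longrightarrow> card (vboundary A) \<le> card (vboundary C))"

definition graph_automorphism :: "(int \<times> int \<Rightarrow> int \<times> int) \<Rightarrow> bool" where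
  "graph_automorphism f \<longleftrightarrow> bij f \<and> (\<forall>p q. adj (f p) (f q) \<longleftrightarrow> adj p q)"

definition congruent_sets :: "(int \<times> int) set \<Rightarrow> (int \<times> int) set \<Rightarrow> bool" where
  "congruent_sets S T \<longleftrightarrow> (\<exists>f. graph_automorphism f \<and> f ` S = T)"

definition box_set :: "int \<Rightarrow> int \<Rightarrow> int \<Rightarrow> int \<Rightarrow> (int \<times> int) set" where
  "box_set a b c d = {(x, y). a \<le> y - x \<and> y - x \<le> b \<and> c \<le> y + x \<and> y + x \<le> d}"

definition is_box :: "(int \<times> int) set \<Rightarrow> bool" where
  "is_box S \<longleftrightarrow> S \<noteq> {} \<and> (\<exists>a b c d. S = box_set a b c d)"

text \<open>Here \<^term>\<open>Least\<close> is taken with respect to inclusion; \<open>enc_least_box\<close> below shows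
  that the smallest box exists for finite nonempty sets.\<close>

definition enc :: "(int \<times> int) set \<Rightarrow> (int \<times> int) set" where
  "enc A = (LEAST S. is_box S \<and> A \<subseteq> S)"

text \<open>The excess may be negative, e.g. it is \<open>-1\<close> for three consecutive points on a diagonal;
  hence the differences are taken in the integers.\<close>

definition Exc :: "(int \<times> int) set \<Rightarrow> int" where
  "Exc A = Max {int (card A) - int (card C) | C.
                  minimal C \<and> card (vboundary C) = card (vboundary A)}"

definition is_cone :: "(int \<times> int) set \<Rightarrow> bool" where
  "is_cone K \<longleftrightarrow> congruent_sets K {(x, y). y - x \<ge> 0 \<and> y + x \<ge> 0}"

definition union_of_cones :: "(int \<times> int) set \<Rightarrow> bool" where
  "union_of_cones S \<longleftrightarrow> (\<exists>F. (\<forall>K\<in>F. is_cone K) \<and> S = \<Union>F)"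

lemma enc_least_box:
  assumes "finite A" "A \<noteq> {}"
  shows "is_box (enc A)" "A \<subseteq> enc A" "\<And>S. is_box S \<Longrightarrow> A \<subseteq> S \<Longrightarrow> enc A \<subseteq> S"
proof -
  let ?u = "(\<lambda>(x, y). y - x) ` A" and ?v = "(\<lambda>(x, y). y + x) ` A"
  let ?B = "box_set (Min ?u) (Max ?u) (Min ?v) (Max ?v)"
  have fin: "finite ?u" "finite ?v" "?u \<noteq> {}" "?v \<noteq> {}" using assms by auto
  have sub: "A \<subseteq> ?B"
  proof (rule subrelI)
    fix x y assume "(x, y) \<in> A"
    then have "y - x \<in> ?u" "y + x \<in> ?v" by force+
    with fin show "(x, y) \<in> ?B" by (simp add: box_set_def)
  qed
  with assms have box: "is_box ?B" by (auto simp: is_box_def)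
  have least: "?B \<subseteq> S" if "is_box S" "A \<subseteq> S" for S
  proof -
    from that obtain a b c d where S: "S = box_set a b c d" by (auto simp: is_box_def)
    have "\<forall>t\<in>?u. a \<le> t \<and> t \<le> b" "\<forall>t\<in>?v. c \<le> t \<and> t \<le> d"
      using that(2) unfolding S box_set_def by auto
    then have "a \<le> Min ?u" "Max ?u \<le> b" "c \<le> Min ?v" "Max ?v \<le> d"
      using fin by simp_all
    then show ?thesis unfolding S box_set_def by auto
  qed
  have "enc A = ?B" unfolding enc_def
    by (rule Least_equality) (use sub box least in auto)
  with sub box least show "is_box (enc A)" "A \<subseteq> enc A"
    "\<And>S. is_box S \<Longrightarrow> A \<subseteq> S \<Longrightarrow> enc A \<subseteq> S" by simp_all
qed

end

theory Submission imports Defs begin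

text \<open>
  In the coordinates \<open>u = y - x\<close>, \<open>w = x + y\<close> the neighbours of \<open>(u, w)\<close> are \<open>(u \<plusminus> 1, w \<plusminus> 1)\<close>.
  Let \<open>h\<close> be the largest size of a row \<open>u = const\<close> of \<open>A\<close>, attained at \<open>u = i0\<close>, and \<open>m\<close> the number
  of nonempty rows. A nonempty row of size \<open>k\<close> has at least \<open>k + 1\<close> neighbours in the next row, so
  telescoping the row sizes outwards from \<open>i0\<close> gives \<open>|\<partial>A| \<ge> 2h + m + 1\<close>. Comparing a minimal set
  with the box having the same \<open>h\<close> and \<open>m\<close> forces equality (up to one extra boundary point in row
  \<open>i0\<close>), and the equality case says that the rows are nested intervals. Hence \<open>|\<partial>A| = |\<partial>(enc A)|\<close> and
  every point outside \<open>A\<close> is the apex of a quadrant missing \<open>A\<close>, that is, of a cone in the complement.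

  Conversely, the least boundary size of an \<open>n\<close>-point set is monotone in \<open>n\<close>, so \<open>N \<le> E\<close>, which
  says that \<open>A\<close> has at least as many points as some minimal set with boundary size \<open>|\<partial>(enc A)|\<close>,
  gives minimality as soon as \<open>|\<partial>A| \<le> |\<partial>(enc A)|\<close>. If the complement of \<open>A\<close> is a union of cones,
  this inequality follows by refilling \<open>enc A\<close> point by point without decreasing the boundary.
\<close>

section \<open>Diagonal coordinates\<close>

definition ucoord :: "int \<times> int \<Rightarrow> int" where
  "ucoord p = snd p - fst p"

definition wcoord :: "int \<times> int \<Rightarrow> int" where
  "wcoord p = fst p + snd p"

text \<open>Only values with the parity of \<open>i\<close> occur, because u + w = 2 * y.\<close>

definition slice :: "(int \<times> int) set \<Rightarrow> int \<Rightarrow> int set" where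
  "slice A i = wcoord ` {p \<in> A. ucoord p = i}"

text \<open>A step in the graph changes both diagonal coordinates by one, so the neighbours of a row
  \<open>X\<close> have these w-coordinates in the next row and equally in the previous one.\<close>

definition nbh :: "int set \<Rightarrow> int set" where
  "nbh X = {v. v - 1 \<in> X \<or> v + 1 \<in> X}"

lemma uw_eqI: "ucoord p = ucoord q \<Longrightarrow> wcoord p = wcoord q \<Longrightarrow> p = q"
  by (cases p; cases q) (simp add: ucoord_def wcoord_def)

lemma ucoord_Pair [simp]: "ucoord (x, y) = y - x"
  by (simp add: ucoord_def)

lemma wcoord_Pair [simp]: "wcoord (x, y) = x + y"
  by (simp add: wcoord_def)

lemma slice_iff: "(x + y) \<in> slice A (y - x) \<longleftrightarrow> (x, y) \<in> A"
proof
  assume "x + y \<in> slice A (y - x)"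
  then obtain p where "p \<in> A" "ucoord p = y - x" "wcoord p = x + y"
    by (auto simp: slice_def)
  moreover have "p = (x, y)" using calculation by (intro uw_eqI) auto
  ultimately show "(x, y) \<in> A" by simp
qed (force simp: slice_def)

lemma sliceE:
  assumes "v \<in> slice A i"
  obtains x y where "(x, y) \<in> A" "v = x + y" "i = y - x"
  using assms by (auto simp: slice_def)

lemma slice_coord_iff: "wcoord p \<in> slice A (ucoord p) \<longleftrightarrow> p \<in> A"
  using slice_iff[of "fst p" "snd p"] by (simp add: ucoord_def wcoord_def)

lemma slice_parity: "v \<in> slice A i \<Longrightarrow> even (v - i)"
  by (elim sliceE) simp

lemma adj_iff:
  "adj (x, y) q \<longleftrightarrow> q = (x + 1, y) \<or> q = (x - 1, y) \<or> q = (x, y + 1) \<or> q = (x, y - 1)"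
  by (cases q) (auto simp: adj_def)

lemma vboundary_iff:
  "(x, y) \<in> vboundary A \<longleftrightarrow> (x, y) \<notin> A \<and>
     ((x + 1, y) \<in> A \<or> (x - 1, y) \<in> A \<or> (x, y + 1) \<in> A \<or> (x, y - 1) \<in> A)"
  by (auto simp: vboundary_def adj_iff)

lemma slice_vboundary:
  "slice (vboundary A) i = nbh (slice A (i - 1) \<union> slice A (i + 1)) - slice A i"
proof -
  have key: "x + y \<in> slice (vboundary A) (y - x) \<longleftrightarrow>
      x + y \<in> nbh (slice A (y - x - 1) \<union> slice A (y - x + 1)) - slice A (y - x)" for x y
    using slice_iff[of "x+1" y A] slice_iff[of "x-1" y A] slice_iff[of x "y+1" A] slice_iff[of x "y-1" A]
    by (auto simp: slice_iff vboundary_iff nbh_def algebra_simps)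
  show ?thesis
  proof (rule set_eqI)
    fix v
    show "v \<in> slice (vboundary A) i \<longleftrightarrow> v \<in> nbh (slice A (i - 1) \<union> slice A (i + 1)) - slice A i"
    proof (cases "even (v - i)")
      case True
      then obtain x where "v - i = 2 * x" by blast
      then have "v = x + (x + i)" "i = (x + i) - x" by auto
      then show ?thesis using key[of x "x + i"] by metis
    next
      \<comment> \<open>No lattice point has coordinates of different parity, so \<open>v\<close>
        lies in neither side.\<close>
      case False
      then show ?thesis
        using slice_parity[of v "vboundary A" i] slice_parity[of "v-1" A "i-1"]
          slice_parity[of "v-1" A "i+1"] slice_parity[of "v+1" A "i-1"] slice_parity[of "v+1" A "i+1"]
        by (auto simp: nbh_def algebra_simps)
    qed
  qed
qed

lemma finite_slice: "finite A \<Longrightarrow> finite (slice A i)"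
  by (simp add: slice_def)

lemma card_eq_sum_slices:
  assumes "finite A" "finite I" "ucoord ` A \<subseteq> I"
  shows "card A = (\<Sum>i\<in>I. card (slice A i))"
proof -
  have "card (slice A i) = card {p \<in> A. ucoord p = i}" for i
    unfolding slice_def by (rule card_image) (auto simp: inj_on_def intro: uw_eqI)
  then show ?thesis
    using sum.group[OF assms, of "\<lambda>_. 1::nat"] by simp
qed

lemma finite_vboundary:
  assumes "finite A" shows "finite (vboundary A)"
proof -
  have "vboundary A \<subseteq> (\<lambda>(x, y). (x + 1, y)) ` A \<union> (\<lambda>(x, y). (x - 1, y)) ` A
      \<union> (\<lambda>(x, y). (x, y + 1)) ` A \<union> (\<lambda>(x, y). (x, y - 1)) ` A"
    by (rule subrelI) (force simp: vboundary_iff image_iff)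
  then show ?thesis by (rule finite_subset) (use assms in auto)
qed

lemma finite_nbh: "finite X \<Longrightarrow> finite (nbh X)"
proof -
  assume "finite X"
  moreover have "nbh X = (\<lambda>x. x + 1) ` X \<union> (\<lambda>x. x - 1) ` X"
    by (force simp: nbh_def)
  ultimately show ?thesis by simp
qed

section \<open>Growth of a row under taking neighbours\<close>

text \<open>The shift of \<open>X\<close> by one lies in \<open>nbh X\<close>, and
  \<open>Min X - 1\<close> is one point more. In the equality case these are all, so
  \<open>x - 1\<close> is either \<open>Min X - 1\<close> or a shifted point.\<close>

lemma card_nbh_ge:
  assumes "finite X" "X \<noteq> {}"
  shows "card X + 1 \<le> card (nbh X)"
    and "card (nbh X) = card X + 1 \<Longrightarrow> x \<in> X \<Longrightarrow> x = Min X \<or> x - 2 \<in> X"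
proof -
  let ?Y = "insert (Min X - 1) ((\<lambda>x. x + 1) ` X)"
  have "Min X - 1 \<notin> (\<lambda>x. x + 1) ` X"
    using Min_le[OF assms(1)] by force
  then have card: "card ?Y = card X + 1"
    using assms(1) by (simp add: card_image)
  have sub: "?Y \<subseteq> nbh X" using Min_in[OF assms] by (auto simp: nbh_def)
  show "card X + 1 \<le> card (nbh X)"
    using card_mono[OF finite_nbh[OF assms(1)] sub] card by simp
  assume "card (nbh X) = card X + 1" and "x \<in> X"
  then have "?Y = nbh X"
    using card_subset_eq[OF finite_nbh[OF assms(1)] sub] card by simp
  moreover have "x - 1 \<in> nbh X" using \<open>x \<in> X\<close> by (simp add: nbh_def)
  ultimately have "x - 1 = Min X - 1 \<or> x - 1 \<in> (\<lambda>x. x + 1) ` X" by blast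
  then show "x = Min X \<or> x - 2 \<in> X" by auto
qed

text \<open>By the equality case of \<open>card_nbh_ge\<close>, descending from \<open>Max X\<close>
  in steps of two stays in \<open>X\<close> until \<open>Min X\<close> is passed.\<close>

lemma parity_interval:
  assumes "finite X" "X \<noteq> {}" "card (nbh X) = card X + 1"
    and "Min X \<le> z" "z \<le> Max X" "even (z - Max X)"
  shows "z \<in> X"
proof -
  have *: "Min X \<le> Max X - 2 * int k \<Longrightarrow> Max X - 2 * int k \<in> X" for k
  proof (induction k)
    case 0 then show ?case using assms by simp
  next
    case (Suc k)
    then have "Max X - 2 * int k \<in> X" "Max X - 2 * int k \<noteq> Min X" by auto
    then have "Max X - 2 * int k - 2 \<in> X" using card_nbh_ge(2)[OF assms(1-3)] by blast
    then show ?case by (simp add: algebra_simps)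
  qed
  obtain j where j: "z - Max X = 2 * j" using assms(6) by blast
  then have "z = Max X - 2 * int (nat (- j))" using assms(5) by simp
  then show ?thesis using *[of "nat (-j)"] assms(4) by simp
qed

lemma parity_interval_length:
  assumes "finite X" "X \<noteq> {}" "card (nbh X) = card X + 1"
  shows "Max X - Min X \<le> 2 * int (card X) - 2" 
proof -
  have ev: "even (Min X - Max X)"
  proof -
    \<comment> \<open>The same descent shows that all elements share the parity of
      \<open>Min X\<close>.\<close>
    have *: "x \<in> X \<Longrightarrow> even (x - Min X)" for x
    proof (induction "nat (x - Min X)" arbitrary: x rule: less_induct)
      case less
      show ?case
      proof (cases "x = Min X")
        case False
        then have "x - 2 \<in> X" using card_nbh_ge(2)[OF assms] less.prems by blast
        moreover from this have "Min X \<le> x - 2" using assms(1) by simp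
        ultimately have "even (x - 2 - Min X)" using less.hyps[of "x - 2"] by simp
        then show ?thesis by presburger
      qed simp
    qed
    show ?thesis using *[of "Max X"] assms(1,2) by (simp add: even_diff)
  qed
  then obtain m where m: "Max X - Min X = 2 * m" by (metis dvd_def even_diff_iff dvd_minus_iff minus_diff_eq)
  have "(\<lambda>k. Min X + 2 * k) ` {0..m} \<subseteq> X"
  proof clarify
    fix k assume "k \<in> {0..m}"
    then show "Min X + 2 * k \<in> X" using m ev by (intro parity_interval[OF assms]) auto
  qed
  then have "card ((\<lambda>k. Min X + 2 * k) ` {0..m}) \<le> card X" using assms(1) by (rule card_mono[rotated])
  then have "nat (m + 1) \<le> card X" by (simp add: card_image inj_on_def)
  then show ?thesis using m by linarith
qed

section \<open>Monotonicity and boxes\<close>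

text \<open>Let \<open>p\<close> be largest in w and, among those points, largest in u. Then
  \<open>p\<close> is the only neighbour in \<open>A\<close> of the point above it, which leaves the
  boundary when \<open>p\<close> is removed, while at most \<open>p\<close> enters.\<close>

lemma ex_removable_point:
  assumes "finite A" "A \<noteq> {}"
  shows "\<exists>p\<in>A. card (vboundary (A - {p})) \<le> card (vboundary A)"
proof -
  let ?m = "Max (wcoord ` A)"
  let ?T = "{p \<in> A. wcoord p = ?m}"
  have "?m \<in> wcoord ` A" using assms by (intro Max_in) auto
  then obtain q where "q \<in> ?T" by force
  then have "ucoord ` ?T \<noteq> {}" by blast
  then have "Max (ucoord ` ?T) \<in> ucoord ` ?T" using assms(1) by (intro Max_in) auto
  then obtain p where p: "p \<in> A" "wcoord p = ?m" "ucoord p = Max (ucoord ` ?T)" by auto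
  have wmax: "wcoord q \<le> wcoord p" if "q \<in> A" for q
    using assms(1) that p(2) by simp
  have umax: "ucoord q \<le> ucoord p" if "q \<in> A" "wcoord q = wcoord p" for q
    using assms(1) that p by simp
  obtain x y where xy: "p = (x, y)" by (cases p)
  have out: "(x, y + 1) \<notin> A" "(x + 1, y + 1) \<notin> A" "(x - 1, y + 1) \<notin> A" "(x, y + 2) \<notin> A"
    using wmax[of "(x, y + 1)"] wmax[of "(x + 1, y + 1)"] wmax[of "(x, y + 2)"]
      umax[of "(x - 1, y + 1)"] by (auto simp: xy)
  have in_bd: "(x, y + 1) \<in> vboundary A"
    using p(1) out by (simp add: vboundary_iff xy)
  have "vboundary (A - {p}) \<subseteq> insert p (vboundary A - {(x, y + 1)})"
    using out by (intro subrelI) (auto simp: vboundary_iff xy ac_simps)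
  then have "card (vboundary (A - {p})) \<le> card (insert p (vboundary A - {(x, y + 1)}))"
    using finite_vboundary[OF assms(1)] by (intro card_mono) auto
  also have "\<dots> \<le> Suc (card (vboundary A - {(x, y + 1)}))"
    by (rule card_insert_le_m1) auto
  also have "\<dots> = card (vboundary A)"
    by (rule card_Suc_Diff1[OF finite_vboundary[OF assms(1)] in_bd])
  finally show ?thesis using p(1) by blast
qed

text \<open>Removing points as in \<open>ex_removable_point\<close> shrinks \<open>A\<close> to the
  size of \<open>C\<close>, where minimality applies.\<close>

lemma minimal_card_vboundary_mono:
  assumes "minimal C" "finite A" "card C \<le> card A"
  shows "card (vboundary C) \<le> card (vboundary A)"
  using assms(2,3)
proof (induction "card A - card C" arbitrary: A)
  case 0
  then show ?case using assms(1) by (simp add: minimal_def)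
next
  case (Suc n)
  then have "A \<noteq> {}" by auto
  then obtain p where p: "p \<in> A" "card (vboundary (A - {p})) \<le> card (vboundary A)"
    using ex_removable_point Suc.prems by blast
  have "card (vboundary C) \<le> card (vboundary (A - {p}))"
    by (rule Suc.hyps(1)) (use Suc.hyps(2) Suc.prems p in auto)
  then show ?case using p by simp
qed

lemma ex_minimal_card: "\<exists>C. minimal C \<and> card C = n"
proof -
  have "infinite (UNIV :: (int \<times> int) set)"
    by (simp add: finite_prod)
  then obtain T :: "(int \<times> int) set" where "finite T" "card T = n"
    using infinite_arbitrarily_large by blast
  then obtain C where "finite C \<and> card C = n"
      "\<And>D. finite D \<and> card D = n \<Longrightarrow> card (vboundary C) \<le> card (vboundary D)"
    using ex_has_least_nat[of "\<lambda>D. finite D \<and> card D = n" T "\<lambda>D. card (vboundary D)"] by blast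
  then show ?thesis unfolding minimal_def by auto
qed

section \<open>Boundary and cardinality of boxes\<close>

lemma mem_box_set_iff:
  "p \<in> box_set a b c d \<longleftrightarrow> a \<le> ucoord p \<and> ucoord p \<le> b \<and> c \<le> wcoord p \<and> wcoord p \<le> d"
  by (cases p) (auto simp: box_set_def)

lemma finite_box_set: "finite (box_set a b c d)"
proof (rule finite_imageD)
  show "finite ((\<lambda>p. (ucoord p, wcoord p)) ` box_set a b c d)"
    by (rule finite_subset[of _ "{a..b} \<times> {c..d}"]) (auto simp: mem_box_set_iff)
  show "inj_on (\<lambda>p. (ucoord p, wcoord p)) (box_set a b c d)"
    by (auto simp: inj_on_def intro: uw_eqI)
qed

text \<open>The boundary lies on the frame of the enlarged rectangle, which is a cycle with
  \<open>2 * ((b - a) + (d - c) + 4)\<close> lattice points in the \<open>(u, w)\<close>-plane; every other one of them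
  comes from \<open>\<int>\<^sup>2\<close>. The map \<open>key\<close> numbers the latter along the cycle.\<close>

lemma card_vboundary_box_le:
  assumes "a \<le> b" "c \<le> d"
  shows "int (card (vboundary (box_set a b c d))) \<le> (b - a) + (d - c) + 4"
proof -
  define S where "S = (b - a) + (d - c) + 4"
  define g where "g = (a + c) div 2"
  define r where "r = (a + c) mod 2"
  \<comment> \<open>The cycle is cut into two paths, along each of which the second coordinate
    changes by one from point to point. The shifts by \<open>g\<close> and \<open>r\<close> put the
    numbers on \<open>low\<close> below those on the other path.\<close>
  define low where "low = (\<lambda>(x, y). x + y \<le> d \<and> (x + y = c - 1 \<or> y - x = b + 1))"
  define key where "key = (\<lambda>p. if low p then snd p - g + 1 - r else S - (snd p - g + 1))"
  let ?F = "vboundary (box_set a b c d)"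
  have gr: "a + c = 2 * g + r" "0 \<le> r" "r \<le> 1" by (auto simp: g_def r_def)
  have frame: "a - 1 \<le> y - x \<and> y - x \<le> b + 1 \<and> c - 1 \<le> x + y \<and> x + y \<le> d + 1 \<and>
      (y - x = a - 1 \<or> y - x = b + 1 \<or> x + y = c - 1 \<or> x + y = d + 1)"
    if "(x, y) \<in> ?F" for x y
    using that by (auto simp: vboundary_iff mem_box_set_iff)
  have low: "x = max (c - 1 - y) (y - b - 1)" "a + c - 2 \<le> 2 * y" "2 * y \<le> a + c + S - 3"
    if "(x, y) \<in> ?F" "low (x, y)" for x y
    using frame[OF that(1)] that(2) assms unfolding low_def S_def by auto
  have high: "x = min (d + 1 - y) (y - a + 1)" "a + c - 1 \<le> 2 * y" "2 * y \<le> a + c + S - 2"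
    if "(x, y) \<in> ?F" "\<not> low (x, y)" for x y
    using frame[OF that(1)] that(2) assms unfolding low_def S_def by auto
  have "inj_on key ?F"
  proof (rule inj_onI, clarify)
    fix x y x' y'
    assume 1: "(x, y) \<in> ?F" and 2: "(x', y') \<in> ?F" and 3: "key (x, y) = key (x', y')"
    have "low (x, y) = low (x', y') \<and> y = y'"
    proof (cases "low (x, y)"; cases "low (x', y')")
      assume l: "low (x, y)" "\<not> low (x', y')"
      then show ?thesis using low(3)[OF 1 l(1)] high(3)[OF 2 l(2)] 3 gr by (simp add: key_def)
    next
      assume l: "\<not> low (x, y)" "low (x', y')"
      then show ?thesis using low(3)[OF 2 l(2)] high(3)[OF 1 l(1)] 3 gr by (simp add: key_def)
    qed (use 3 in \<open>auto simp: key_def\<close>)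
    then show "x = x' \<and> y = y'" using low(1)[OF 1] low(1)[OF 2] high(1)[OF 1] high(1)[OF 2] by metis
  qed
  moreover have "key ` ?F \<subseteq> {0..<S}"
  proof clarify
    fix x y assume 1: "(x, y) \<in> ?F"
    show "key (x, y) \<in> {0..<S}"
    proof (cases "low (x, y)")
      case True
      then show ?thesis using low(2,3)[OF 1] gr assms by (simp add: key_def S_def)
    next
      case False
      then show ?thesis using high(2,3)[OF 1] gr assms by (simp add: key_def S_def)
    qed
  qed
  ultimately have "card (vboundary (box_set a b c d)) \<le> card {0..<S}"
    by (intro card_inj_on_le) auto
  then show ?thesis using assms by (simp add: S_def)
qed

lemma slice_box_set:
  assumes "a \<le> i" "i \<le> b"
  shows "slice (box_set a b c d) i = {v. c \<le> v \<and> v \<le> d \<and> even (v - i)}"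
proof (intro set_eqI iffI)
  fix v assume "v \<in> {v. c \<le> v \<and> v \<le> d \<and> even (v - i)}"
  then obtain x where "v - i = 2 * x" "c \<le> v" "v \<le> d" by blast
  then have "(x, x + i) \<in> box_set a b c d" "v = x + (x + i)"
    using assms by (auto simp: mem_box_set_iff)
  then show "v \<in> slice (box_set a b c d) i" using slice_iff[of x "x + i"] by simp
qed (auto elim!: sliceE simp: mem_box_set_iff)

text \<open>The elements are \<open>i mod 2 + 2 * j\<close>; the hypothesis says that the one with
  \<open>j = k - 1\<close> is still at most \<open>d\<close>.\<close>

lemma card_parity_class_ge:
  assumes "i mod 2 + 2 * int k \<le> d + 2"
  shows "k \<le> card {v. 0 \<le> v \<and> v \<le> d \<and> even (v - i)}"
proof -
  have "(\<lambda>j. 2 * int j + i mod 2) ` {..<k} \<subseteq> {v. 0 \<le> v \<and> v \<le> d \<and> even (v - i)}"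
    using assms by auto
  moreover have "finite {v. 0 \<le> v \<and> v \<le> d \<and> even (v - i)}"
    by (rule finite_subset[of _ "{0..d}"]) auto
  ultimately have "card ((\<lambda>j. 2 * int j + i mod 2) ` {..<k}) \<le> card {v. 0 \<le> v \<and> v \<le> d \<and> even (v - i)}"
    by (rule card_mono[rotated])
  then show ?thesis by (simp add: card_image inj_on_def)
qed

lemma card_box_eq_sum:
  "card (box_set 0 (int m - 1) 0 d) = (\<Sum>i<m. card {v. 0 \<le> v \<and> v \<le> d \<and> even (v - int i)})"
proof -
  have "card (box_set 0 (int m - 1) 0 d) = (\<Sum>i\<in>int ` {..<m}. card (slice (box_set 0 (int m - 1) 0 d) i))"
  proof (rule card_eq_sum_slices)
    show "ucoord ` box_set 0 (int m - 1) 0 d \<subseteq> int ` {..<m}"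
    proof clarify
      fix x y assume "(x, y) \<in> box_set 0 (int m - 1) 0 d"
      then show "ucoord (x, y) \<in> int ` {..<m}"
        by (intro image_eqI[of _ _ "nat (y - x)"]) (auto simp: mem_box_set_iff)
    qed
  qed (auto simp: finite_box_set)
  also have "\<dots> = (\<Sum>i<m. card {v. 0 \<le> v \<and> v \<le> d \<and> even (v - int i)})"
    by (subst sum.reindex) (auto simp: slice_box_set intro!: sum.cong)
  finally show ?thesis .
qed

text \<open>Among \<open>2 * h\<close> consecutive integers there are \<open>h\<close> of either
  parity, so every row has \<open>h\<close> points.\<close>

lemma card_box_odd_side_ge: "m * h \<le> card (box_set 0 (int m - 1) 0 (2 * int h - 1))"
proof -
  have "m * h = (\<Sum>i<m. h)" by simp
  also have "\<dots> \<le> card (box_set 0 (int m - 1) 0 (2 * int h - 1))"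
    unfolding card_box_eq_sum by (intro sum_mono card_parity_class_ge) (use pos_mod_bound[of 2] in simp)
  finally show ?thesis .
qed

text \<open>From \<open>0\<close> to \<open>2 * h - 2\<close> there are \<open>h\<close> even and
  \<open>h - 1\<close> odd numbers, so the row sizes alternate, beginning with
  \<open>h\<close>.\<close>

lemma card_box_even_side_ge:
  assumes "h \<ge> 1"
  shows "m * (h - 1) + (m + 1) div 2 \<le> card (box_set 0 (int m - 1) 0 (2 * int h - 2))"
proof -
  obtain k where k: "h = Suc k" using assms by (cases h) auto
  have "m * k + (m + 1) div 2 = (\<Sum>i<m. if even i then Suc k else k)"
    by (induction m) auto
  then have "m * (h - 1) + (m + 1) div 2 = (\<Sum>i<m. if even i then h else h - 1)"
    unfolding k diff_Suc_1 .
  also have "\<dots> \<le> card (box_set 0 (int m - 1) 0 (2 * int h - 2))"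
    unfolding card_box_eq_sum
  proof (rule sum_mono)
    fix i
    have "int i mod 2 = of_bool (odd i)" by (simp add: mod_2_eq_odd)
    then show "(if even i then h else h - 1) \<le> card {v. 0 \<le> v \<and> v \<le> 2 * int h - 2 \<and> even (v - int i)}"
      using assms by (intro card_parity_class_ge) (auto simp: of_nat_diff)
  qed
  finally show ?thesis .
qed

section \<open>The isoperimetric inequality and its equality case\<close>

definition toward :: "int \<Rightarrow> int \<Rightarrow> int" where
  "toward i0 i = (if i > i0 then i - 1 else i + 1)"

definition away :: "int \<Rightarrow> int \<Rightarrow> int" where
  "away i0 i = (if i > i0 then i + 1 else i - 1)"

text \<open>The number of boundary points that the inner neighbouring row forces into row
  \<open>i\<close>: its neighbourhood has at least one point more than itself, and row
  \<open>i\<close> absorbs at most its own size. The value may be negative. It is zero at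
  \<open>i0\<close>, from where the sum telescopes in both directions.\<close>

definition slice_drop :: "(int \<times> int) set \<Rightarrow> int \<Rightarrow> int \<Rightarrow> int" where
  "slice_drop A i0 i = (if i = i0 then 0 else
     int (card (slice A (toward i0 i))) + of_bool (slice A (toward i0 i) \<noteq> {}) - int (card (slice A i)))"

lemma slice_nonempty_iff: "slice A i \<noteq> {} \<longleftrightarrow> i \<in> ucoord ` A"
  unfolding slice_def by blast

lemma slice_vboundary_toward_away:
  assumes "i \<noteq> i0"
  shows "slice (vboundary A) i = nbh (slice A (toward i0 i)) \<union> nbh (slice A (away i0 i)) - slice A i"
  by (auto simp: slice_vboundary toward_def away_def nbh_def)

lemma card_Diff_nbh_ge:
  assumes "finite X" "finite Y" "X \<noteq> {}"
  shows "int (card X) + 1 - int (card Y) \<le> int (card (nbh X - Y))"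
  using card_nbh_ge(1)[OF assms(1,3)] diff_card_le_card_Diff[OF assms(2), of "nbh X"] by linarith

lemma slice_drop_le:
  assumes "finite A"
  shows "slice_drop A i0 i \<le> int (card (slice (vboundary A) i))"
proof (cases "i = i0 \<or> slice A (toward i0 i) = {}")
  case True
  then show ?thesis by (auto simp: slice_drop_def)
next
  case False
  then have "slice_drop A i0 i = int (card (slice A (toward i0 i))) + 1 - int (card (slice A i))"
    by (simp add: slice_drop_def)
  also have "\<dots> \<le> int (card (nbh (slice A (toward i0 i)) - slice A i))"
    using False assms by (intro card_Diff_nbh_ge finite_slice) auto
  also have "\<dots> \<le> int (card (slice (vboundary A) i))"
    unfolding of_nat_le_iff using False assms
    by (intro card_mono finite_slice finite_vboundary) (auto simp: slice_vboundary_toward_away)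
  finally show ?thesis .
qed

lemma telescope_int:
  fixes f c :: "int \<Rightarrow> int"
  assumes "m \<le> n"
  shows "(\<Sum>i\<in>{m+1..n+1}. f (i - 1) + c (i - 1) - f i) = f m - f (n + 1) + (\<Sum>i\<in>{m..n}. c i)"
  using assms
proof (induction n rule: int_ge_induct)
  case base
  have "{m+1..m+1} = {m+1}" "{m..m} = {m}" by auto
  then show ?case by simp
next
  case (step n)
  have "{m+1..n+1+1} = insert (n+1+1) {m+1..n+1}" "{m..n+1} = insert (n+1) {m..n}"
    using step.hyps by auto
  then show ?case using step.IH by (simp add: add.commute[of 1])
qed

lemma telescope_int_down:
  fixes f c :: "int \<Rightarrow> int"
  assumes "m \<le> n"
  shows "(\<Sum>i\<in>{m-1..n-1}. f (i + 1) + c (i + 1) - f i) = f n - f (m - 1) + (\<Sum>i\<in>{m..n}. c i)"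
proof -
  have "(\<Sum>i\<in>{m-1..n-1}. f (i + 1) + c (i + 1) - f i)
      = (\<Sum>i\<in>{-n+1..-m+1}. f (- (i - 1)) + c (- (i - 1)) - f (- i))"
    by (rule sum.reindex_bij_witness[of _ uminus uminus]) (auto simp: add.commute)
  also have "\<dots> = f (- (- n)) - f (- (- m + 1)) + (\<Sum>i\<in>{-n..-m}. c (- i))"
    by (rule telescope_int[of "-n" "-m" "\<lambda>i. f (- i)" "\<lambda>i. c (- i)"]) (use assms in simp)
  also have "(\<Sum>i\<in>{-n..-m}. c (- i)) = (\<Sum>i\<in>{m..n}. c i)"
    by (rule sum.reindex_bij_witness[of _ uminus uminus]) auto
  finally show ?thesis by simp
qed

text \<open>The last sum is the surplus over the drops. Each of the two telescoping sums yields the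
  size of row \<open>i0\<close> and counts the nonempty rows on its side; both count row
  \<open>i0\<close>, hence the \<open>+ 1\<close>.\<close>

lemma card_vboundary_eq:
  assumes "finite A" "i0 \<in> ucoord ` A"
  obtains I where "finite I" "ucoord ` A \<subseteq> I"
    "\<forall>i. i \<notin> I \<longrightarrow> slice (vboundary A) i = {} \<and> slice_drop A i0 i = 0"
    "int (card (vboundary A)) = 2 * int (card (slice A i0)) + int (card (ucoord ` A)) + 1
       + (\<Sum>i\<in>I. int (card (slice (vboundary A) i)) - slice_drop A i0 i)"
proof
  \<comment> \<open>\<open>A\<close> lives in the rows from \<open>- K\<close> to \<open>K\<close>;
    one more row on each side catches the rest of the boundary.\<close>
  define K where "K = Max (abs ` ucoord ` A)"
  let ?I = "{-K-1..K+1}"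
  let ?a = "\<lambda>i. int (card (slice A i))" and ?c = "\<lambda>i. of_bool (slice A i \<noteq> {}) :: int"
  have abs_le: "\<bar>i\<bar> \<le> K" if "i \<in> ucoord ` A" for i
    unfolding K_def using that assms(1) by (intro Max_ge) auto
  then have empty: "slice A i = {}" if "\<bar>i\<bar> > K" for i
    using that abs_le[of i] slice_nonempty_iff[of A i] by linarith
  have i0: "-K \<le> i0" "i0 \<le> K" using abs_le[OF assms(2)] by auto
  show "ucoord ` A \<subseteq> ?I"
  proof
    fix i assume "i \<in> ucoord ` A"
    then show "i \<in> ?I" using abs_le[of i] by auto
  qed
  show fin: "finite ?I" by simp
  have out: "slice (vboundary A) i = {} \<and> slice_drop A i0 i = 0" if "i \<notin> ?I" for i
    using that i0 empty[of i] empty[of "i - 1"] empty[of "i + 1"]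
    by (auto simp: slice_vboundary slice_drop_def toward_def nbh_def)
  then show "\<forall>i. i \<notin> ?I \<longrightarrow> slice (vboundary A) i = {} \<and> slice_drop A i0 i = 0" by blast
  have "card (vboundary A) = (\<Sum>i\<in>?I. card (slice (vboundary A) i))"
  proof (rule card_eq_sum_slices[OF finite_vboundary[OF assms(1)] fin])
    show "ucoord ` vboundary A \<subseteq> ?I" using out slice_nonempty_iff by blast
  qed
  moreover have "(\<Sum>i\<in>?I. slice_drop A i0 i) = 2 * ?a i0 + int (card (ucoord ` A)) + 1"
  proof -
    have I: "?I = insert i0 ({i0+1..K+1} \<union> {-K-1..i0-1})" using i0 by auto
    have "(\<Sum>i\<in>?I. slice_drop A i0 i)
        = (\<Sum>i\<in>{i0+1..K+1}. slice_drop A i0 i) + (\<Sum>i\<in>{-K-1..i0-1}. slice_drop A i0 i)"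
    proof -
      have "(\<Sum>i\<in>?I. slice_drop A i0 i) = (\<Sum>i\<in>{i0+1..K+1} \<union> {-K-1..i0-1}. slice_drop A i0 i)"
        unfolding I by (subst sum.insert) (auto simp: slice_drop_def[of A i0 i0])
      then show ?thesis by (subst (asm) sum.union_disjoint) auto
    qed
    also have "(\<Sum>i\<in>{i0+1..K+1}. slice_drop A i0 i) = (\<Sum>i\<in>{i0+1..K+1}. ?a (i - 1) + ?c (i - 1) - ?a i)"
      by (intro sum.cong) (auto simp: slice_drop_def toward_def)
    also have "\<dots> = ?a i0 - ?a (K + 1) + (\<Sum>i\<in>{i0..K}. ?c i)"
      by (rule telescope_int[OF i0(2)])
    also have "(\<Sum>i\<in>{-K-1..i0-1}. slice_drop A i0 i) = (\<Sum>i\<in>{-K-1..i0-1}. ?a (i + 1) + ?c (i + 1) - ?a i)"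
      by (intro sum.cong) (auto simp: slice_drop_def toward_def)
    also have "\<dots> = ?a i0 - ?a (-K - 1) + (\<Sum>i\<in>{-K..i0}. ?c i)"
      by (rule telescope_int_down[OF i0(1)])
    also have "?a (K + 1) = 0" using empty[of "K + 1"] i0 by simp
    also have "?a (-K - 1) = 0" using empty[of "-K - 1"] i0 by simp
    \<comment> \<open>The second count of row \<open>i0\<close> is split off, so that the two ranges
      become disjoint.\<close>
    also have "(\<Sum>i\<in>{-K..i0}. ?c i) = 1 + (\<Sum>i\<in>{-K..i0-1}. ?c i)"
    proof -
      have "{-K..i0} = insert i0 {-K..i0-1}" using i0 by auto
      then show ?thesis using assms(2) slice_nonempty_iff[of A i0] by simp
    qed
    also have "?a i0 - 0 + (\<Sum>i\<in>{i0..K}. ?c i) + (?a i0 - 0 + (1 + (\<Sum>i\<in>{-K..i0-1}. ?c i)))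
        = 2 * ?a i0 + (\<Sum>i\<in>{i0..K} \<union> {-K..i0-1}. ?c i) + 1"
      by (subst sum.union_disjoint) auto
    also have "{i0..K} \<union> {-K..i0-1} = {-K..K}" using i0 by auto
    also have "(\<Sum>i\<in>{-K..K}. ?c i) = (\<Sum>i\<in>{-K..K}. of_bool (i \<in> ucoord ` A))"
      by (simp add: slice_nonempty_iff)
    also have "\<dots> = int (card (ucoord ` A))"
    proof -
      have "i \<in> {-K..K}" if "i \<in> ucoord ` A" for i using abs_le[OF that] by auto
      then have "{-K..K} \<inter> {i. i \<in> ucoord ` A} = ucoord ` A" by blast
      then show ?thesis by (simp add: sum_of_bool_eq)
    qed
    finally show ?thesis .
  qed
  ultimately show "int (card (vboundary A)) = 2 * ?a i0 + int (card (ucoord ` A)) + 1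
       + (\<Sum>i\<in>?I. int (card (slice (vboundary A) i)) - slice_drop A i0 i)"
    by (simp add: sum_subtractf)
qed

text \<open>All surplus terms are nonnegative, so those outside \<open>T\<close> may be dropped.
  With \<open>T\<close> empty this is the isoperimetric inequality.\<close>

lemma card_vboundary_ge:
  assumes "finite A" "i0 \<in> ucoord ` A" "T \<subseteq> ucoord ` A"
  shows "int (card (vboundary A)) \<ge> 2 * int (card (slice A i0)) + int (card (ucoord ` A)) + 1
       + (\<Sum>i\<in>T. int (card (slice (vboundary A) i)) - slice_drop A i0 i)"
proof -
  obtain I where I: "finite I" "ucoord ` A \<subseteq> I"
    "\<forall>i. i \<notin> I \<longrightarrow> slice (vboundary A) i = {} \<and> slice_drop A i0 i = 0"
    "int (card (vboundary A)) = 2 * int (card (slice A i0)) + int (card (ucoord ` A)) + 1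
       + (\<Sum>i\<in>I. int (card (slice (vboundary A) i)) - slice_drop A i0 i)"
    by (rule card_vboundary_eq[OF assms(1,2)])
  have "(\<Sum>i\<in>T. int (card (slice (vboundary A) i)) - slice_drop A i0 i)
      \<le> (\<Sum>i\<in>I. int (card (slice (vboundary A) i)) - slice_drop A i0 i)"
    using I assms slice_drop_le[OF assms(1), of i0] by (intro sum_mono2) auto
  then show ?thesis using I by linarith
qed

text \<open>At \<open>i0\<close> the drop is zero, so the boundary points there are pure surplus. If
  they already use up the permitted total \<delta>, no other row has any surplus.\<close>

lemma card_vboundary_tight:
  assumes "finite A" "i0 \<in> ucoord ` A" "\<delta> \<le> card (slice (vboundary A) i0)"
    and "int (card (vboundary A)) \<le> 2 * int (card (slice A i0)) + int (card (ucoord ` A)) + 1 + int \<delta>"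
  shows "card (slice (vboundary A) i0) = \<delta>"
    and "i \<noteq> i0 \<Longrightarrow> int (card (slice (vboundary A) i)) = slice_drop A i0 i"
    and "int (card (vboundary A)) = 2 * int (card (slice A i0)) + int (card (ucoord ` A)) + 1 + int \<delta>"
proof -
  let ?s = "\<lambda>i. int (card (slice (vboundary A) i)) - slice_drop A i0 i"
  obtain I where I: "finite I" "ucoord ` A \<subseteq> I"
    "\<forall>i. i \<notin> I \<longrightarrow> slice (vboundary A) i = {} \<and> slice_drop A i0 i = 0"
    "int (card (vboundary A)) = 2 * int (card (slice A i0)) + int (card (ucoord ` A)) + 1
       + (\<Sum>i\<in>I. ?s i)"
    by (rule card_vboundary_eq[OF assms(1,2)])
  have i0: "i0 \<in> I" using I(2) assms(2) by blast
  have nonneg: "?s i \<ge> 0" for i using slice_drop_le[OF assms(1)] by simp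
  have s0: "?s i0 = int (card (slice (vboundary A) i0))" by (simp add: slice_drop_def)
  have split: "(\<Sum>i\<in>I. ?s i) = ?s i0 + (\<Sum>i\<in>I - {i0}. ?s i)"
    using I(1) i0 by (rule sum.remove)
  have "(\<Sum>i\<in>I - {i0}. ?s i) \<ge> 0" using nonneg by (intro sum_nonneg) auto
  then have *: "(\<Sum>i\<in>I - {i0}. ?s i) = 0" "card (slice (vboundary A) i0) = \<delta>"
    using split s0 I(4) assms(3,4) by linarith+
  then show "card (slice (vboundary A) i0) = \<delta>"
    "int (card (vboundary A)) = 2 * int (card (slice A i0)) + int (card (ucoord ` A)) + 1 + int \<delta>"
    using split s0 I(4) by linarith+
  have zero: "\<forall>i\<in>I - {i0}. ?s i = 0"
    using *(1) I(1) nonneg by (subst (asm) sum_nonneg_eq_0_iff) auto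
  show "int (card (slice (vboundary A) i)) = slice_drop A i0 i" if "i \<noteq> i0"
    using zero I(3) that by (cases "i \<in> I") auto
qed

section \<open>Minimal sets attain the bound\<close>

lemma card_le_rows:
  assumes "finite A" "\<And>i. card (slice A i) \<le> h"
  shows "card A \<le> card (ucoord ` A) * h"
    and "card A + card {i \<in> ucoord ` A. card (slice A i) \<noteq> h} \<le> card (ucoord ` A) * h"
proof -
  let ?R = "ucoord ` A"
  have 1: "card A = (\<Sum>i\<in>?R. card (slice A i))"
    using assms(1) by (intro card_eq_sum_slices) auto
  have "card {i \<in> ?R. card (slice A i) \<noteq> h} = (\<Sum>i\<in>?R. of_bool (card (slice A i) \<noteq> h))"
    using assms(1) by (simp add: sum_of_bool_eq Int_def)
  then have "card A + card {i \<in> ?R. card (slice A i) \<noteq> h}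
      = (\<Sum>i\<in>?R. card (slice A i) + of_bool (card (slice A i) \<noteq> h))"
    using 1 by (simp add: sum.distrib)
  also have "\<dots> \<le> (\<Sum>i\<in>?R. h)"
  proof (rule sum_mono)
    fix i show "card (slice A i) + of_bool (card (slice A i) \<noteq> h) \<le> h"
      using assms(2)[of i] by (cases "card (slice A i) = h") auto
  qed
  finally show "card A + card {i \<in> ?R. card (slice A i) \<noteq> h} \<le> card ?R * h" by simp
  then show "card A \<le> card ?R * h" by simp
qed

text \<open>The comparison box has \<open>card (ucoord ` A)\<close> rows, of size \<open>h\<close> throughout (\<open>\<delta> = 1\<close>) or alternately
  \<open>h\<close> and \<open>h - 1\<close> (\<open>\<delta> = 0\<close>). Two points of the form \<open>(x, y)\<close>, \<open>(x - 1, y + 1)\<close> are minimal with an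
  empty row between them, which is the only obstruction to tightness.\<close>

lemma minimal_tight:
  assumes min: "minimal A" and ne: "A \<noteq> {}" and n2: "card A \<noteq> 2"
  obtains i0 \<delta> where "i0 \<in> ucoord ` A" "\<delta> \<le> 1" "card (slice (vboundary A) i0) = \<delta>"
    "\<And>i. i \<noteq> i0 \<Longrightarrow> int (card (slice (vboundary A) i)) = slice_drop A i0 i"
    "int (card (vboundary A)) = 2 * int (card (slice A i0)) + int (card (ucoord ` A)) + 1 + int \<delta>"
proof -
  have fin: "finite A" using min by (simp add: minimal_def)
  let ?R = "ucoord ` A" and ?a = "\<lambda>i. card (slice A i)"
  define w where "w = card ?R"
  define h where "h = Max (?a ` ?R)"
  have finR: "finite ?R" using fin by simp
  have w: "w \<ge> 1" using ne finR by (simp add: w_def Suc_le_eq card_gt_0_iff)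
  have R_iff: "i \<in> ?R \<longleftrightarrow> ?a i > 0" for i
    using slice_nonempty_iff[of A i] finite_slice[OF fin, of i] by (simp add: card_gt_0_iff)
  have le_h: "?a i \<le> h" for i
  proof (cases "i \<in> ?R")
    case True then show ?thesis unfolding h_def using finR by (intro Max_ge) auto
  next
    case False then show ?thesis using R_iff by auto
  qed
  have "h \<in> ?a ` ?R" unfolding h_def using finR ne by (intro Max_in) auto
  then obtain i1 where i1: "i1 \<in> ?R" "?a i1 = h" by auto
  then have h: "h \<ge> 1" using R_iff[of i1] by simp
  have up: "int (card (vboundary A)) \<le> 2 * int h + int w + 2"
  proof -
    have "card A \<le> w * h" using card_le_rows(1)[OF fin le_h] by (simp add: w_def)
    also have "\<dots> \<le> card (box_set 0 (int w - 1) 0 (2 * int h - 1))" by (rule card_box_odd_side_ge)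
    finally have "card (vboundary A) \<le> card (vboundary (box_set 0 (int w - 1) 0 (2 * int h - 1)))"
      by (intro minimal_card_vboundary_mono[OF min] finite_box_set)
    then show ?thesis
      using card_vboundary_box_le[of 0 "int w - 1" 0 "2 * int h - 1"] w h by linarith
  qed
  show ?thesis
  proof (cases "\<exists>i. ?a i = h \<and> ?a (i + 1) = h")
    case True
    \<comment> \<open>Row \<open>i + 1\<close> has at least \<open>h + 1\<close> neighbours in row
      \<open>i\<close>, which holds only \<open>h\<close> points of \<open>A\<close>. So row
      \<open>i\<close>, taken as reference row, contains a boundary point, and \<delta> = 1 is
      possible.\<close>
    then obtain i where i: "?a i = h" "?a (i + 1) = h" by blast
    then have iR: "i \<in> ?R" using R_iff h by simp
    have "slice A (i + 1) \<noteq> {}" using i(2) h by auto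
    then have "1 \<le> int (card (nbh (slice A (i + 1)) - slice A i))"
      using card_Diff_nbh_ge[of "slice A (i + 1)" "slice A i"] finite_slice[OF fin] i by simp
    also have "\<dots> \<le> int (card (slice (vboundary A) i))"
      unfolding of_nat_le_iff
      by (intro card_mono finite_slice finite_vboundary fin) (auto simp: slice_vboundary nbh_def)
    finally have 1: "1 \<le> card (slice (vboundary A) i)" by simp
    have 2: "int (card (vboundary A)) \<le> 2 * int (?a i) + int (card ?R) + 1 + int 1"
      using up i by (simp add: w_def)
    show ?thesis
      using that[OF iR order_refl card_vboundary_tight(1)[OF fin iR 1 2]
          card_vboundary_tight(2)[OF fin iR 1 2] card_vboundary_tight(3)[OF fin iR 1 2]] .
  next
    case no_adj: False
    let ?M = "{i \<in> ?R. ?a i = h}" and ?N = "{i \<in> ?R. ?a i \<noteq> h}"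
    have card_R: "w = card ?M + card ?N"
    proof -
      have "card (?M \<union> ?N) = card ?M + card ?N" using finR by (intro card_Un_disjoint) auto
      moreover have "?M \<union> ?N = ?R" by blast
      ultimately show ?thesis unfolding w_def by simp
    qed
    have bound: "card A + card ?N \<le> w * h"
      using card_le_rows(2)[OF fin le_h] by (simp add: w_def)
    show ?thesis
    proof (cases "2 * card ?M \<le> w + 1")
      case True
      \<comment> \<open>Each row in \<open>?N\<close> lacks a point, so \<open>card A\<close> is at
        most \<open>w * (h - 1) + card ?M\<close>, and the alternating box is large enough.\<close>
      obtain k where k: "h = Suc k" using h by (cases h) auto
      have "card A \<le> w * (h - 1) + (w + 1) div 2"
        using bound card_R True by (simp add: k)
      also have "\<dots> \<le> card (box_set 0 (int w - 1) 0 (2 * int h - 2))"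
        by (rule card_box_even_side_ge[OF h])
      finally have "card (vboundary A) \<le> card (vboundary (box_set 0 (int w - 1) 0 (2 * int h - 2)))"
        by (intro minimal_card_vboundary_mono[OF min] finite_box_set)
      then have 2: "int (card (vboundary A)) \<le> 2 * int (?a i1) + int (card ?R) + 1 + int 0"
        using card_vboundary_box_le[of 0 "int w - 1" 0 "2 * int h - 2"] w h i1 by (simp add: w_def)
      show ?thesis
        using that[OF i1(1) _ card_vboundary_tight(1)[OF fin i1(1) le0 2]
            card_vboundary_tight(2)[OF fin i1(1) le0 2] card_vboundary_tight(3)[OF fin i1(1) le0 2]]
        by simp
    next
      case False
      \<comment> \<open>Full rows whose inner neighbouring row is empty. Every other full row except
        \<open>i1\<close> has a nonempty, non-full inner row, so \<open>toward\<close> injects these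
        into \<open>?N\<close>.\<close>
      let ?G = "{i \<in> ?M - {i1}. toward i1 i \<notin> ?R}"
      have inj: "inj_on (toward i1) (?M - {i1} - ?G)"
      proof (rule inj_onI)
        fix i j assume ij: "i \<in> ?M - {i1} - ?G" "j \<in> ?M - {i1} - ?G" "toward i1 i = toward i1 j"
        \<comment> \<open>On each side of \<open>i1\<close> the map is injective; a clash between
          the sides would need the two rows next to \<open>i1\<close>, and these are not
          full.\<close>
        have "?a (i1 + 1) \<noteq> h" "?a (i1 - 1) \<noteq> h"
          using no_adj[simplified, rule_format, of i1] no_adj[simplified, rule_format, of "i1 - 1"] i1(2)
          by auto
        then have "i \<noteq> i1 + 1" "i \<noteq> i1 - 1" "j \<noteq> i1 + 1" "j \<noteq> i1 - 1"
          using ij(1,2) by blast+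
        then show "i = j" using ij by (auto simp: toward_def split: if_splits)
      qed
      have "toward i1 ` (?M - {i1} - ?G) \<subseteq> ?N"
      proof (rule image_subsetI)
        fix i assume i: "i \<in> ?M - {i1} - ?G"
        have "?a (toward i1 i) \<noteq> h"
          using i no_adj[simplified, rule_format, of i] no_adj[simplified, rule_format, of "i - 1"]
          by (auto simp: toward_def)
        then show "toward i1 i \<in> ?N" using i by blast
      qed
      then have "card (?M - {i1} - ?G) \<le> card ?N"
        using inj finR by (intro card_inj_on_le) auto
      moreover have "card (?M - {i1} - ?G) = card ?M - 1 - card ?G"
        using finR i1 by (subst card_Diff_subset) auto
      ultimately have G: "2 * card ?M \<le> w + 1 + card ?G" using card_R by linarith
      \<comment> \<open>A row of \<open>?G\<close> has drop \<open>- h\<close>, so it contributes at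
        least \<open>h\<close> to the surplus, for which \<open>up\<close> leaves room for only
        1.\<close>
      have "int h * int (card ?G) = (\<Sum>i\<in>?G. int h)" by simp
      also have "\<dots> \<le> (\<Sum>i\<in>?G. int (card (slice (vboundary A) i)) - slice_drop A i1 i)"
      proof (rule sum_mono)
        fix i assume "i \<in> ?G"
        then have "slice A (toward i1 i) = {}" "i \<noteq> i1" "?a i = h"
          using slice_nonempty_iff[of A "toward i1 i"] by auto
        then show "int h \<le> int (card (slice (vboundary A) i)) - slice_drop A i1 i"
          by (simp add: slice_drop_def)
      qed
      finally have "int (h * card ?G) \<le> int 1"
        using card_vboundary_ge[OF fin i1(1), of ?G] up i1(2) by (auto simp: w_def)
      then have "h * card ?G \<le> 1" unfolding of_nat_le_iff .
      moreover have "card ?G \<ge> 1" using G False by linarith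
      ultimately have "h * card ?G = 1" using h mult_le_mono[of 1 h 1 "card ?G"] by linarith
      then have h1: "h = 1" and G1: "card ?G = 1" unfolding nat_mult_eq_1_iff by blast+
      \<comment> \<open>Now all rows are singletons, and the two estimates for
        \<open>card ?M\<close> leave exactly two rows, the excluded size.\<close>
      have a1: "?a i = 1" if "i \<in> ?R" for i
        using le_h[of i] h1 R_iff[of i] that by linarith
      then have "?N = {}" using h1 by blast
      then have "w = card ?M" using card_R by (simp only: card.empty add_0_right)
      then have "w = 2" using False G G1 by linarith
      moreover have "card A = w"
      proof -
        have "card A = (\<Sum>i\<in>?R. ?a i)" using fin by (intro card_eq_sum_slices) auto
        also have "\<dots> = (\<Sum>i\<in>?R. 1)" using a1 by (intro sum.cong refl)
        finally show ?thesis by (simp add: w_def)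
      qed
      ultimately show ?thesis using n2 by simp
    qed
  qed
qed

section \<open>Free quadrants\<close>

text \<open>The closed quadrant of the (u, w)-plane with apex \<open>p\<close> and directions
  \<sigma>, \<tau> misses \<open>A\<close>. In the (x, y)-plane it is a cone, see
  \<open>quadrant_is_cone\<close>.\<close>

definition free_quadrant :: "(int \<times> int) set \<Rightarrow> int \<times> int \<Rightarrow> int \<Rightarrow> int \<Rightarrow> bool" where
  "free_quadrant A p \<sigma> \<tau> \<longleftrightarrow>
     (\<forall>q\<in>A. \<sigma> * (ucoord q - ucoord p) \<ge> 0 \<longrightarrow> \<tau> * (wcoord q - wcoord p) < 0)"

definition has_free_quadrant :: "(int \<times> int) set \<Rightarrow> int \<times> int \<Rightarrow> bool" where
  "has_free_quadrant A p \<longleftrightarrow> (\<exists>\<sigma>\<in>{1, -1}. \<exists>\<tau>\<in>{1, -1}. free_quadrant A p \<sigma> \<tau>)"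

lemma has_free_quadrantI:
  "free_quadrant A p \<sigma> \<tau> \<Longrightarrow> \<sigma> \<in> {1, -1} \<Longrightarrow> \<tau> \<in> {1, -1} \<Longrightarrow> has_free_quadrant A p"
  unfolding has_free_quadrant_def by blast

lemma has_free_quadrant_outside_box:
  assumes "A \<subseteq> box_set a b c d" "p \<notin> box_set a b c d"
  shows "has_free_quadrant A p"
proof -
  have bds: "a \<le> ucoord q \<and> ucoord q \<le> b \<and> c \<le> wcoord q \<and> wcoord q \<le> d" if "q \<in> A" for q
    using assms(1) that by (auto simp: mem_box_set_iff)
  consider "ucoord p < a" | "ucoord p > b" | "wcoord p < c" | "wcoord p > d"
    using assms(2) by (auto simp: mem_box_set_iff)
  then show ?thesis
  proof cases
    case 1
    then have "free_quadrant A p (-1) 1" using bds by (fastforce simp: free_quadrant_def)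
    then show ?thesis by (rule has_free_quadrantI) auto
  next
    case 2
    then have "free_quadrant A p 1 1" using bds by (fastforce simp: free_quadrant_def)
    then show ?thesis by (rule has_free_quadrantI) auto
  next
    case 3
    then have "free_quadrant A p 1 (-1)" using bds by (fastforce simp: free_quadrant_def)
    then show ?thesis by (rule has_free_quadrantI) auto
  next
    case 4
    then have "free_quadrant A p 1 1" using bds by (fastforce simp: free_quadrant_def)
    then show ?thesis by (rule has_free_quadrantI) auto
  qed
qed

text \<open>\<open>nbh\<close> moves the minimum and the maximum of a nonempty set outwards by
  exactly one, so bounds can be compared through it.\<close>

lemma nbh_subset_bounds:
  assumes "finite X" "nbh X \<subseteq> nbh Y" "Y \<subseteq> {c..d}"
  shows "X \<subseteq> {c..d}"
proof (cases "X = {}")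
  case False
  have "nbh Y \<subseteq> {c-1..d+1}"
  proof
    fix y assume "y \<in> nbh Y"
    then have "y - 1 \<in> {c..d} \<or> y + 1 \<in> {c..d}" using assms(3) unfolding nbh_def by blast
    then show "y \<in> {c-1..d+1}" by auto
  qed
  moreover have "Min X - 1 \<in> nbh X" "Max X + 1 \<in> nbh X"
    using Min_in[OF assms(1) False] Max_in[OF assms(1) False] by (auto simp: nbh_def)
  ultimately have "c - 1 \<le> Min X - 1" "Max X + 1 \<le> d + 1" using assms(2) by auto
  then have "c \<le> x \<and> x \<le> d" if "x \<in> X" for x
    using Min_le[OF assms(1) that] Max_ge[OF assms(1) that] by linarith
  then show ?thesis by auto
qed simp

text \<open>The inclusion links sets at distance two, so the bounds start from one set for each
  parity of \<open>k\<close>.\<close>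

lemma nbh_chain_bounds:
  fixes f :: "nat \<Rightarrow> int set"
  assumes "\<And>k. finite (f k)" "\<And>k. nbh (f (Suc (Suc k))) \<subseteq> nbh (f k)"
    and "f 0 \<subseteq> {c..d}" "f (Suc 0) \<subseteq> {c..d}"
  shows "f k \<subseteq> {c..d}"
proof (induction k rule: induct_nat_012)
  case (ge2 k)
  then show ?case using nbh_subset_bounds[OF assms(1,2)] by blast
qed (use assms in auto)

section \<open>Shape of tight sets\<close>

text \<open>The outcome of \<open>minimal_tight\<close>: the boundary exceeds the telescoped bound
  by \<delta>, and this surplus sits entirely in row \<open>i0\<close>.\<close>

locale tight_set =
  fixes A :: "(int \<times> int) set" and i0 :: int and \<delta> :: nat
  assumes fin: "finite A" and i0: "i0 \<in> ucoord ` A" and \<delta>: "\<delta> \<le> 1"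
    and tight0: "card (slice (vboundary A) i0) = \<delta>"
    and tight: "i \<noteq> i0 \<Longrightarrow> int (card (slice (vboundary A) i)) = slice_drop A i0 i"
    and total: "int (card (vboundary A)) =
      2 * int (card (slice A i0)) + int (card (ucoord ` A)) + 1 + int \<delta>"
begin

text \<open>Equality in \<open>slice_drop_le\<close> forces equality in every estimate behind it:
  the inner row absorbs row \<open>i\<close> in its neighbourhood, this neighbourhood has the least
  possible size, and the outer row adds no boundary points.\<close>

lemma slices:
  assumes "i \<noteq> i0"
  shows "slice A i \<subseteq> nbh (slice A (toward i0 i))"
    and "nbh (slice A (away i0 i)) \<subseteq> nbh (slice A (toward i0 i))"
    and "slice A (toward i0 i) \<noteq> {} \<Longrightarrow>
      card (nbh (slice A (toward i0 i))) = card (slice A (toward i0 i)) + 1"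
proof -
  let ?X = "slice A (toward i0 i)" and ?Y = "slice A i" and ?Z = "nbh (slice A (away i0 i))"
  have finX: "finite (nbh ?X)" and finY: "finite ?Y" and finZ: "finite ?Z"
    using fin by (simp_all add: finite_nbh finite_slice)
  have eq: "int (card (nbh ?X \<union> ?Z - ?Y)) = slice_drop A i0 i"
    using tight[OF assms] slice_vboundary_toward_away[OF assms, of A] by simp
  have "?Y \<subseteq> nbh ?X \<and> ?Z \<subseteq> nbh ?X \<and> (?X \<noteq> {} \<longrightarrow> card (nbh ?X) = card ?X + 1)"
  proof (cases "?X = {}")
    case True
    then have "nbh ?X = {}" by (simp add: nbh_def)
    have "int (card (nbh ?X \<union> ?Z - ?Y)) = - int (card ?Y)"
      using eq True assms by (simp add: slice_drop_def)
    then have "card (nbh ?X \<union> ?Z - ?Y) = 0" "card ?Y = 0" by linarith+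
    then have "?Y = {}" "nbh ?X \<union> ?Z - ?Y = {}" using finX finY finZ by auto
    then show ?thesis using True by auto
  next
    case False
    have 1: "int (card (nbh ?X \<union> ?Z - ?Y)) = int (card ?X) + 1 - int (card ?Y)"
      using eq False assms by (simp add: slice_drop_def)
    have 2: "card (nbh ?X) \<ge> card ?X + 1"
      using card_nbh_ge(1)[OF finite_slice[OF fin] False] .
    have 3: "card (nbh ?X) = card (nbh ?X - ?Y) + card (nbh ?X \<inter> ?Y)"
      using card_Int_Diff[OF finX, of ?Y] by simp
    have 4: "card (nbh ?X \<inter> ?Y) \<le> card ?Y" using finY by (simp add: card_mono)
    have 5: "card (nbh ?X - ?Y) \<le> card (nbh ?X \<union> ?Z - ?Y)"
      using finX finZ by (intro card_mono) auto
    have e: "card (nbh ?X \<inter> ?Y) = card ?Y" "card (nbh ?X - ?Y) = card (nbh ?X \<union> ?Z - ?Y)"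
      "card (nbh ?X) = card ?X + 1"
      using 1 2 3 4 5 by linarith+
    have "nbh ?X \<inter> ?Y = ?Y" using e(1) finY by (intro card_subset_eq) auto
    moreover have "nbh ?X - ?Y = nbh ?X \<union> ?Z - ?Y"
      using e(2) finX finZ by (intro card_subset_eq) auto
    ultimately show ?thesis using e(3) by blast
  qed
  then show "?Y \<subseteq> nbh ?X" "?Z \<subseteq> nbh ?X" "?X \<noteq> {} \<Longrightarrow> card (nbh ?X) = card ?X + 1"
    by blast+
qed

text \<open>Every row is the inner neighbour of some row further out, so the last part of
  \<open>slices\<close> applies to it.\<close>

lemma slice_interval:
  assumes "slice A i \<noteq> {}"
  shows "card (nbh (slice A i)) = card (slice A i) + 1"
proof (cases "i \<ge> i0")
  case True
  then have "toward i0 (i + 1) = i" by (simp add: toward_def)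
  then show ?thesis using slices(3)[of "i + 1"] assms True by simp
next
  case False
  then have "toward i0 (i - 1) = i" by (simp add: toward_def)
  then show ?thesis using slices(3)[of "i - 1"] assms False by simp
qed

text \<open>Going outwards, the neighbourhood of each row is contained in that of the row two steps
  before, so bounds on two consecutive rows propagate.\<close>

lemma far_slices:
  assumes \<sigma>: "\<sigma> \<in> {1, -1}" and j: "\<sigma> * (j - i0) \<ge> 0"
    and b: "slice A j \<subseteq> {c..d}" "slice A (j + \<sigma>) \<subseteq> {c..d}" and i: "\<sigma> * (i - j) \<ge> 0"
  shows "slice A i \<subseteq> {c..d}"
proof -
  define f where "f = (\<lambda>k. slice A (j + \<sigma> * int k))"
  have chain: "nbh (f (Suc (Suc k))) \<subseteq> nbh (f k)" for k
  proof -
    let ?i = "j + \<sigma> * (int k + 1)"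
    consider "\<sigma> = 1" | "\<sigma> = -1" using \<sigma> by blast
    then have "?i \<noteq> i0 \<and> toward i0 ?i = j + \<sigma> * int k \<and> away i0 ?i = j + \<sigma> * int (Suc (Suc k))"
      using j by cases (simp_all add: toward_def away_def)
    then show ?thesis using slices(2)[of ?i] by (simp add: f_def)
  qed
  have "finite (f k)" for k by (simp add: f_def finite_slice fin)
  moreover have "f 0 \<subseteq> {c..d}" "f (Suc 0) \<subseteq> {c..d}" using b by (simp_all add: f_def)
  ultimately have "f (nat (\<sigma> * (i - j))) \<subseteq> {c..d}"
    using nbh_chain_bounds[of f] chain by blast
  moreover have "j + \<sigma> * int (nat (\<sigma> * (i - j))) = i" using \<sigma> i by auto
  ultimately show ?thesis by (simp add: f_def)
qed

lemma next_slice: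
  assumes \<sigma>: "\<sigma> \<in> {1, -1}" and j: "\<sigma> * (j - i0) \<ge> 0"
  shows "slice A (j + \<sigma>) \<subseteq> nbh (slice A j)"
proof -
  have "j + \<sigma> \<noteq> i0" "toward i0 (j + \<sigma>) = j" using \<sigma> j by (auto simp: toward_def)
  then show ?thesis using slices(1)[of "j + \<sigma>"] by simp
qed

text \<open>The interval is the range of row \<open>i0\<close>, extended by one at a single end if
  \<delta> = 1. It contains rows \<open>i0 - 1\<close>, \<open>i0\<close> and \<open>i0 + 1\<close>,
  and \<open>far_slices\<close> carries it to all others.\<close>

lemma core_bounds:
  obtains c d where "d - c \<le> 2 * int (card (slice A i0)) - 2 + int \<delta>"
    "\<forall>i. slice A i \<subseteq> {c..d}" "\<forall>v. c \<le> v \<and> v \<le> d \<and> even (v - i0) \<longrightarrow> v \<in> slice A i0"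
proof -
  let ?X = "slice A i0"
  let ?l = "Min ?X" and ?r = "Max ?X"
  let ?Y = "slice A (i0 - 1) \<union> slice A (i0 + 1)"
  have ne: "?X \<noteq> {}" using i0 slice_nonempty_iff by blast
  note X = finite_slice[OF fin, of i0] ne slice_interval[OF ne]
  have len: "?r - ?l \<le> 2 * int (card ?X) - 2" by (rule parity_interval_length[OF X])
  have lr: "?l \<in> ?X" "?r \<in> ?X" using X by auto
  have par: "even (?l - i0)" "even (?r - i0)" using lr slice_parity by blast+
  have full: "v \<in> ?X" if "?l - 1 \<le> v" "v \<le> ?r + 1" "even (v - i0)" for v
  proof (rule parity_interval[OF X])
    \<comment> \<open>The two additional values have the wrong parity.\<close>
    have "v \<noteq> ?l - 1" "v \<noteq> ?r + 1" using that(3) par by auto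
    then show "?l \<le> v" "v \<le> ?r" using that by linarith+
    show "even (v - ?r)" using that(3) par(2) by auto
  qed
  have Xb: "x \<in> ?X \<Longrightarrow> ?l \<le> x \<and> x \<le> ?r" for x using X(1) by simp
  have "?Y \<subseteq> nbh ?X" using next_slice[of 1 i0] next_slice[of "-1" i0] by auto
  then have Yn: "y - 1 \<in> ?X \<or> y + 1 \<in> ?X" if "y \<in> ?Y" for y using that unfolding nbh_def by blast
  have Yb: "?l - 1 \<le> y \<and> y \<le> ?r + 1" if "y \<in> ?Y" for y
    using Yn[OF that] Xb[of "y - 1"] Xb[of "y + 1"] by linarith
  have Ysub: "?Y \<subseteq> {c..d}"
    if "c = ?l - 1 \<or> c = ?l \<and> ?l - 1 \<notin> ?Y" "d = ?r + 1 \<or> d = ?r \<and> ?r + 1 \<notin> ?Y" for c d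
  proof
    fix y assume y: "y \<in> ?Y"
    then have "y = ?l - 1 \<Longrightarrow> ?l - 1 \<in> ?Y" "y = ?r + 1 \<Longrightarrow> ?r + 1 \<in> ?Y" by simp_all
    then show "y \<in> {c..d}" using Yb[OF y] that unfolding atLeastAtMost_iff by linarith
  qed
  have finD: "finite (nbh ?Y - ?X)" using fin by (simp add: finite_nbh finite_slice)
  have cardD: "card (nbh ?Y - ?X) = \<delta>" using tight0 by (simp add: slice_vboundary)
  \<comment> \<open>A neighbouring row that sticks out at one end of row \<open>i0\<close> creates a
    boundary point in row \<open>i0\<close>. Only \<delta> of these exist, so at most one end is
    affected, and none if \<delta> = 0.\<close>
  have hi: "?r + 2 \<in> nbh ?Y - ?X" if "?r + 1 \<in> ?Y"
    using that Xb[of "?r + 2"] by (auto simp: nbh_def ac_simps)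
  have lo: "?l - 2 \<in> nbh ?Y - ?X" if "?l - 1 \<in> ?Y"
    using that Xb[of "?l - 2"] by (auto simp: nbh_def)
  have lele: "?l \<le> ?r" using Xb lr by blast
  have "\<exists>c d. ?l - 1 \<le> c \<and> c \<le> ?l \<and> ?r \<le> d \<and> d \<le> ?r + 1 \<and> d - c \<le> ?r - ?l + int \<delta> \<and> ?Y \<subseteq> {c..d}"
  proof (cases "?r + 1 \<in> ?Y")
    case True
    have "?l - 1 \<notin> ?Y"
    proof
      assume "?l - 1 \<in> ?Y"
      then have "card {?l - 2, ?r + 2} \<le> card (nbh ?Y - ?X)"
        using lo hi True by (intro card_mono finD) auto
      then show False using cardD \<delta> lele by simp
    qed
    moreover have "card (nbh ?Y - ?X) > 0"
      unfolding card_gt_0_iff using hi[OF True] finD by blast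
    then have "\<delta> = 1" using cardD \<delta> by simp
    ultimately have "?Y \<subseteq> {?l..?r + 1}" using Ysub[of ?l "?r + 1"] True by auto
    then show ?thesis using \<open>\<delta> = 1\<close> by (intro exI[of _ ?l] exI[of _ "?r + 1"]) auto
  next
    case noR: False
    show ?thesis
    proof (cases "?l - 1 \<in> ?Y")
      case True
      have "card (nbh ?Y - ?X) > 0"
        unfolding card_gt_0_iff using lo[OF True] finD by blast
      then have "\<delta> = 1" using cardD \<delta> by simp
      moreover have "?Y \<subseteq> {?l - 1..?r}" using Ysub[of "?l - 1" ?r] noR by auto
      ultimately show ?thesis by (intro exI[of _ "?l - 1"] exI[of _ ?r]) auto
    next
      case False
      then have "?Y \<subseteq> {?l..?r}" using Ysub[of ?l ?r] noR by auto
      then show ?thesis by (intro exI[of _ ?l] exI[of _ ?r]) auto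
    qed
  qed
  then obtain c d where cd: "?l - 1 \<le> c" "c \<le> ?l" "?r \<le> d" "d \<le> ?r + 1"
    "d - c \<le> ?r - ?l + int \<delta>" "?Y \<subseteq> {c..d}" by blast
  have "?X \<subseteq> {c..d}" using Xb cd by force
  then have "slice A i \<subseteq> {c..d}" for i
    using far_slices[of 1 i0 c d i] far_slices[of "-1" i0 c d i] cd(6) by (cases "i \<ge> i0") auto
  moreover have "d - c \<le> 2 * int (card ?X) - 2 + int \<delta>" using cd(5) len by linarith
  moreover have "v \<in> ?X" if "c \<le> v" "v \<le> d" "even (v - i0)" for v
    using full[of v] that cd by linarith
  ultimately show ?thesis using that[of d c] by blast
qed

text \<open>A nonempty row has a nonempty inner neighbour, so walking inwards from both extreme rows
  meets no gap.\<close>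

lemma card_ucoords_ge: "Max (ucoord ` A) - Min (ucoord ` A) + 1 \<le> int (card (ucoord ` A))"
proof -
  let ?R = "ucoord ` A"
  have finR: "finite ?R" "?R \<noteq> {}" using fin i0 by auto
  have inward: "toward i0 i \<in> ?R" if "i \<noteq> i0" "i \<in> ?R" for i
  proof -
    have "slice A i \<noteq> {}" using that(2) slice_nonempty_iff by blast
    then have "slice A (toward i0 i) \<noteq> {}" using slices(1)[OF that(1)] by (auto simp: nbh_def)
    then show ?thesis using slice_nonempty_iff by blast
  qed
  have right: "j \<ge> i0 \<longrightarrow> j \<in> ?R" if "j \<le> Max ?R" for j
    using that
  proof (induction j rule: int_le_induct)
    case base then show ?case using finR by simp
  next
    case (step j)
    show ?case
    proof
      assume "i0 \<le> j - 1"
      then have "j \<in> ?R" "j \<noteq> i0" "toward i0 j = j - 1" using step.IH by (simp_all add: toward_def)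
      then show "j - 1 \<in> ?R" using inward[of j] by simp
    qed
  qed
  have left: "j \<le> i0 \<longrightarrow> j \<in> ?R" if "Min ?R \<le> j" for j
    using that
  proof (induction j rule: int_ge_induct)
    case base then show ?case using finR by simp
  next
    case (step j)
    show ?case
    proof
      assume "j + 1 \<le> i0"
      then have "j \<in> ?R" "j \<noteq> i0" "toward i0 j = j + 1" using step.IH by (simp_all add: toward_def)
      then show "j + 1 \<in> ?R" using inward[of j] by simp
    qed
  qed
  have "{Min ?R..Max ?R} \<subseteq> ?R"
  proof
    fix j assume "j \<in> {Min ?R..Max ?R}"
    then show "j \<in> ?R" using left[of j] right[of j] by (cases "j \<le> i0") auto
  qed
  then have "card {Min ?R..Max ?R} \<le> card ?R" using finR by (intro card_mono) auto
  then show ?thesis by simp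
qed

text \<open>The w-extent is at most \<open>d - c\<close> in \<open>core_bounds\<close> and the
  u-extent at most the number of rows minus one; their sum plus four is bounded by
  \<open>total\<close>.\<close>

lemma card_vboundary_ge_extent:
  "(Max (ucoord ` A) - Min (ucoord ` A)) + (Max (wcoord ` A) - Min (wcoord ` A)) + 4
    \<le> int (card (vboundary A))"
proof -
  obtain c d where cd: "d - c \<le> 2 * int (card (slice A i0)) - 2 + int \<delta>"
    "\<forall>i. slice A i \<subseteq> {c..d}" "\<forall>v. c \<le> v \<and> v \<le> d \<and> even (v - i0) \<longrightarrow> v \<in> slice A i0"
    by (rule core_bounds)
  have "wcoord p \<in> {c..d}" if "p \<in> A" for p
    using cd(2) slice_coord_iff[of p A] that by blast
  moreover have "Min (wcoord ` A) \<in> wcoord ` A" "Max (wcoord ` A) \<in> wcoord ` A"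
    using fin i0 by (intro Min_in Max_in; blast)+
  ultimately have "Min (wcoord ` A) \<in> {c..d}" "Max (wcoord ` A) \<in> {c..d}" by (metis imageE)+
  then have "c \<le> Min (wcoord ` A)" "Max (wcoord ` A) \<le> d" by simp_all
  then show ?thesis using cd(1) total card_ucoords_ge by linarith
qed

text \<open>In row \<open>i0\<close> the point \<open>p\<close> lies outside the common range of all
  rows. In any other row parity keeps it at distance at least two from the range of a nonempty row,
  whereas the rows further out exceed that range by at most one.\<close>

lemma free_quadrant_outside:
  assumes "p \<notin> A" shows "has_free_quadrant A p"
proof -
  let ?i = "ucoord p" and ?v = "wcoord p"
  have vn: "?v \<notin> slice A ?i" using assms by (simp add: slice_coord_iff)
  have ev: "even (?v - ?i)" by (cases p) simp
  have in_slice: "wcoord q \<in> slice A (ucoord q)" if "q \<in> A" for q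
    using that by (simp add: slice_coord_iff)
  show ?thesis
  proof (cases "?i = i0")
    case True
    obtain c d where cd: "d - c \<le> 2 * int (card (slice A i0)) - 2 + int \<delta>"
      "\<forall>i. slice A i \<subseteq> {c..d}" "\<forall>v. c \<le> v \<and> v \<le> d \<and> even (v - i0) \<longrightarrow> v \<in> slice A i0"
      by (rule core_bounds)
    have "wcoord q \<in> {c..d}" if "q \<in> A" for q
      using cd(2) in_slice[OF that] by blast
    then have wb: "c \<le> wcoord q \<and> wcoord q \<le> d" if "q \<in> A" for q
      using that by auto
    have "\<not> (c \<le> ?v \<and> ?v \<le> d)" using cd(3) vn ev True by auto
    then consider "?v < c" | "?v > d" by linarith
    then show ?thesis
    proof cases
      case 1
      then have "free_quadrant A p 1 (-1)" using wb by (fastforce simp: free_quadrant_def)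
      then show ?thesis by (rule has_free_quadrantI) auto
    next
      case 2
      then have "free_quadrant A p 1 1" using wb by (fastforce simp: free_quadrant_def)
      then show ?thesis by (rule has_free_quadrantI) auto
    qed
  next
    case False
    define \<sigma> where "\<sigma> = sgn (?i - i0)"
    have \<sigma>: "\<sigma> \<in> {1, -1}" "\<sigma> * (?i - i0) \<ge> 0" using False by (auto simp: \<sigma>_def sgn_if)
    have far: "c \<le> wcoord q \<and> wcoord q \<le> d"
      if "slice A ?i \<subseteq> {c..d}" "nbh (slice A ?i) \<subseteq> {c..d}" "q \<in> A" "\<sigma> * (ucoord q - ?i) \<ge> 0" for c d q
    proof -
      have "slice A (ucoord q) \<subseteq> {c..d}"
        by (rule far_slices[OF \<sigma> that(1) _ that(4)]) (use next_slice[OF \<sigma>] that(2) in blast)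
      then show ?thesis using in_slice[OF that(3)] by auto
    qed
    show ?thesis
    proof (cases "slice A ?i = {}")
      case True
      then have "nbh (slice A ?i) = {}" by (simp add: nbh_def)
      \<comment> \<open>The bounds \<open>?v + 1\<close> and \<open>?v\<close> enclose an empty
        interval: beyond an empty row there are no points of \<open>A\<close>.\<close>
      then have "free_quadrant A p \<sigma> 1"
        using far[of "?v + 1" ?v] True by (fastforce simp: free_quadrant_def)
      then show ?thesis using \<sigma>(1) by (rule has_free_quadrantI) auto
    next
      case ne: False
      let ?X = "slice A ?i"
      note X = finite_slice[OF fin, of ?i] ne slice_interval[OF ne]
      have Xb: "x \<in> ?X \<Longrightarrow> Min ?X \<le> x \<and> x \<le> Max ?X" for x using X(1) by simp
      have sub: "?X \<subseteq> {Min ?X - 1..Max ?X + 1}" using Xb by force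
      have subN: "nbh ?X \<subseteq> {Min ?X - 1..Max ?X + 1}" 
        using Xb by (force simp: nbh_def)
      have par: "even (Min ?X - ?i)" "even (Max ?X - ?i)"
        using X slice_parity[of _ A ?i] by auto
      have "even (?v - Max ?X)" using par ev by auto
      then consider "?v < Min ?X" | "?v > Max ?X"
        using parity_interval[OF X, of ?v] vn by linarith
      then show ?thesis
      proof cases
        case 1
        moreover have "?v \<noteq> Min ?X - 1" using par ev by auto
        ultimately have "?v < Min ?X - 1" by linarith
        then have "free_quadrant A p \<sigma> (-1)"
          using far[OF sub subN] by (fastforce simp: free_quadrant_def)
        then show ?thesis using \<sigma>(1) by (rule has_free_quadrantI) auto
      next
        case 2
        moreover have "?v \<noteq> Max ?X + 1" using par ev by auto
        ultimately have "?v > Max ?X + 1" by linarith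
        then have "free_quadrant A p \<sigma> 1"
          using far[OF sub subN] by (fastforce simp: free_quadrant_def)
        then show ?thesis using \<sigma>(1) by (rule has_free_quadrantI) auto
      qed
    qed
  qed
qed

end

section \<open>Minimal sets\<close>

text \<open>For parity reasons a box can have several parameter quadruples; the extremes over
  \<open>A\<close> are the tight ones, suited to \<open>card_vboundary_box_le\<close>.\<close>

lemma enc_eq_box:
  assumes "finite A" "A \<noteq> {}"
  shows "enc A = box_set (Min (ucoord ` A)) (Max (ucoord ` A)) (Min (wcoord ` A)) (Max (wcoord ` A))"
    (is "_ = ?B")
proof
  have sub: "A \<subseteq> ?B" using assms by (auto simp: mem_box_set_iff simp del: ucoord_Pair wcoord_Pair)
  then have "is_box ?B" using assms(2) unfolding is_box_def by blast
  then show "enc A \<subseteq> ?B" using sub by (rule enc_least_box(3)[OF assms])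
  obtain a b c d where e: "enc A = box_set a b c d"
    using enc_least_box(1)[OF assms] by (auto simp: is_box_def)
  have "Min (ucoord ` A) \<in> ucoord ` A" "Max (ucoord ` A) \<in> ucoord ` A"
    "Min (wcoord ` A) \<in> wcoord ` A" "Max (wcoord ` A) \<in> wcoord ` A"
    using assms by auto
  moreover have "a \<le> ucoord p \<and> ucoord p \<le> b \<and> c \<le> wcoord p \<and> wcoord p \<le> d" if "p \<in> A" for p
    using enc_least_box(2)[OF assms] that unfolding e by (auto simp: mem_box_set_iff)
  ultimately have "a \<le> Min (ucoord ` A)" "Max (ucoord ` A) \<le> b" "c \<le> Min (wcoord ` A)" "Max (wcoord ` A) \<le> d"
    by (metis imageE)+
  then show "?B \<subseteq> enc A" unfolding e by (auto simp: mem_box_set_iff)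
qed

section \<open>Sets of one or two points\<close>

lemma card_vboundary_singleton: "card (vboundary {p}) = 4"
proof -
  obtain x y where "p = (x, y)" by (cases p)
  moreover have "vboundary {(x, y)} = {(x + 1, y), (x - 1, y), (x, y + 1), (x, y - 1)}"
    by (auto simp: vboundary_iff)
  ultimately show ?thesis by simp
qed

text \<open>Both distances in the first coordinate are at most one, so they equal one on opposite
  sides, which leaves nothing for the second coordinate.\<close>

lemma midpoint_unique:
  fixes a b x y x' y' :: int
  assumes "\<bar>a - x\<bar> + \<bar>b - y\<bar> = 1" "\<bar>a - x'\<bar> + \<bar>b - y'\<bar> = 1" "\<bar>x - x'\<bar> \<ge> 2"
  shows "2 * a = x + x'" "2 * b = y + y'"
proof -
  have "\<bar>a - x\<bar> \<le> 1" "\<bar>a - x'\<bar> \<le> 1" using assms(1,2) by simp_all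
  then have a: "a - x = 1 \<and> a - x' = - 1 \<or> a - x = - 1 \<and> a - x' = 1"
    using assms(3) by linarith
  then show "2 * a = x + x'" by linarith
  have "\<bar>b - y\<bar> = 0" "\<bar>b - y'\<bar> = 0" using assms(1,2) a by auto
  then show "2 * b = y + y'" by simp
qed

text \<open>The points are not adjacent, and a common neighbour can only be their midpoint; this
  leaves at least 4 + 4 - 1 points.\<close>

lemma card_vboundary_pair_far:
  assumes far: "\<bar>x - x'\<bar> \<ge> 2 \<or> \<bar>y - y'\<bar> \<ge> 2"
  shows "7 \<le> card (vboundary {(x, y), (x', y')})"
proof -
  let ?N = "vboundary {(x, y)}" and ?N' = "vboundary {(x', y')}"
  have "?N \<inter> ?N' \<subseteq> {((x + x') div 2, (y + y') div 2)}"
  proof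
    fix z assume z: "z \<in> ?N \<inter> ?N'"
    obtain a b where ab: "z = (a, b)" by (cases z)
    have *: "\<bar>a - x\<bar> + \<bar>b - y\<bar> = 1" "\<bar>a - x'\<bar> + \<bar>b - y'\<bar> = 1"
      using z by (auto simp: ab vboundary_def adj_def)
    then have "2 * a = x + x' \<and> 2 * b = y + y'"
      using far midpoint_unique[of a x b y x' y'] midpoint_unique[of b y a x y' x']
      by (metis add.commute)
    then show "z \<in> {((x + x') div 2, (y + y') div 2)}" unfolding ab by auto
  qed
  then have "card (?N \<inter> ?N') \<le> card {((x + x') div 2, (y + y') div 2)}"
    by (rule card_mono[rotated]) simp
  then have "card (?N \<inter> ?N') \<le> 1" by simp
  moreover have "card (?N \<union> ?N') + card (?N \<inter> ?N') = card ?N + card ?N'"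
    by (rule card_Un_Int[symmetric]) (simp_all add: finite_vboundary)
  moreover have "\<not> adj (x, y) (x', y')" "\<not> adj (x', y') (x, y)" using far by (auto simp: adj_def)
  then have "?N \<union> ?N' \<subseteq> vboundary {(x, y), (x', y')}" unfolding vboundary_def by blast
  then have "card (?N \<union> ?N') \<le> card (vboundary {(x, y), (x', y')})"
    by (intro card_mono finite_vboundary) auto
  ultimately show ?thesis by (simp add: card_vboundary_singleton)
qed

lemma pair_eq_boxI:
  assumes "a \<le> y - x \<and> y - x \<le> b \<and> c \<le> x + y \<and> x + y \<le> d"
    and "a \<le> y' - x' \<and> y' - x' \<le> b \<and> c \<le> x' + y' \<and> x' + y' \<le> d"
    and "\<And>s t. a \<le> t - s \<and> t - s \<le> b \<and> c \<le> s + t \<and> s + t \<le> d \<Longrightarrow>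
      s = x \<and> t = y \<or> s = x' \<and> t = y'"
  shows "{(x, y), (x', y')} = box_set a b c d"
proof
  show "{(x, y), (x', y')} \<subseteq> box_set a b c d" using assms(1,2) by (simp add: mem_box_set_iff)
  show "box_set a b c d \<subseteq> {(x, y), (x', y')}"
    by (rule subrelI) (use assms(3) in \<open>simp add: mem_box_set_iff\<close>)
qed

text \<open>Up to exchange there are four relative positions. In each the coordinate ranges have
  total length 2, for which the box bound is 6, and six boundary points are listed
  explicitly.\<close>

lemma near_pair_is_box:
  assumes "p \<noteq> q" "\<bar>fst p - fst q\<bar> \<le> 1" "\<bar>snd p - snd q\<bar> \<le> 1"
  obtains a b c d where "{p, q} = box_set a b c d" "b - a + (d - c) = 2" "6 \<le> card (vboundary {p, q})"
proof -
  have ge6: "6 \<le> card (vboundary {p, q})" if "S \<subseteq> vboundary {p, q}" "card S = 6" for S p q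
    using card_mono[OF finite_vboundary that(1)] that(2) by simp
  have *: "\<exists>a b c d. {(x, y), (x', y')} = box_set a b c d \<and> b - a + (d - c) = 2 \<and>
      6 \<le> card (vboundary {(x, y), (x', y')})"
    if nb: "(x', y') \<in> {(x + 1, y), (x, y + 1), (x + 1, y + 1), (x + 1, y - 1)}" for x y x' y'
  proof -
    consider "x' = x + 1" "y' = y" | "x' = x" "y' = y + 1" | "x' = x + 1" "y' = y + 1"
      | "x' = x + 1" "y' = y - 1" using nb by auto
    then show ?thesis
    proof cases
      case 1
      have B: "{(x, y), (x', y')} = box_set (y - x - 1) (y - x) (x + y) (x + y + 1)"
        unfolding 1 by (rule pair_eq_boxI; presburger)
      have G: "6 \<le> card (vboundary {(x, y), (x', y')})"
        by (rule ge6[of "{(x - 1, y), (x, y + 1), (x, y - 1), (x + 2, y), (x + 1, y + 1), (x + 1, y - 1)}"])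
          (auto simp: 1 vboundary_iff)
      show ?thesis by (intro exI conjI, rule B, simp, rule G)
    next
      case 2
      have B: "{(x, y), (x', y')} = box_set (y - x) (y - x + 1) (x + y) (x + y + 1)"
        unfolding 2 by (rule pair_eq_boxI; presburger)
      have G: "6 \<le> card (vboundary {(x, y), (x', y')})"
        by (rule ge6[of "{(x, y - 1), (x + 1, y), (x - 1, y), (x, y + 2), (x + 1, y + 1), (x - 1, y + 1)}"])
          (auto simp: 2 vboundary_iff)
      show ?thesis by (intro exI conjI, rule B, simp, rule G)
    next
      case 3
      have B: "{(x, y), (x', y')} = box_set (y - x) (y - x) (x + y) (x + y + 2)"
        unfolding 3 by (rule pair_eq_boxI; presburger)
      have G: "6 \<le> card (vboundary {(x, y), (x', y')})"
        by (rule ge6[of "{(x, y - 1), (x - 1, y), (x + 1, y), (x, y + 1), (x + 2, y + 1), (x + 1, y + 2)}"])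
          (auto simp: 3 vboundary_iff)
      show ?thesis by (intro exI conjI, rule B, simp, rule G)
    next
      case 4
      have B: "{(x, y), (x', y')} = box_set (y - x - 2) (y - x) (x + y) (x + y)"
        unfolding 4 by (rule pair_eq_boxI; presburger)
      have G: "6 \<le> card (vboundary {(x, y), (x', y')})"
        by (rule ge6[of "{(x, y + 1), (x - 1, y), (x + 1, y), (x, y - 1), (x + 2, y - 1), (x + 1, y - 2)}"])
          (auto simp: 4 vboundary_iff)
      show ?thesis by (intro exI conjI, rule B, simp, rule G)
    qed
  qed
  obtain x y x' y' where pq: "p = (x, y)" "q = (x', y')" by (cases p; cases q)
  have "(x', y') \<in> {(x + 1, y), (x, y + 1), (x + 1, y + 1), (x + 1, y - 1)} \<or>
      (x, y) \<in> {(x' + 1, y'), (x', y' + 1), (x' + 1, y' + 1), (x' + 1, y' - 1)}"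
  proof -
    have "x' = x - 1 \<or> x' = x \<or> x' = x + 1" "y' = y - 1 \<or> y' = y \<or> y' = y + 1"
      using assms(2,3) unfolding pq fst_conv snd_conv by linarith+
    then show ?thesis using assms(1) unfolding pq by (elim disjE) simp_all
  qed
  then show ?thesis
  proof
    assume "(x', y') \<in> {(x + 1, y), (x, y + 1), (x + 1, y + 1), (x + 1, y - 1)}"
    from *[OF this] show ?thesis using that unfolding pq by blast
  next
    assume "(x, y) \<in> {(x' + 1, y'), (x', y' + 1), (x' + 1, y' + 1), (x' + 1, y' - 1)}"
    from *[OF this] show ?thesis using that unfolding pq insert_commute[of "(x', y')"] by blast
  qed
qed

lemma card_vboundary_pair_ge:
  assumes "p \<noteq> q" shows "6 \<le> card (vboundary {p, q})"
proof (cases "\<bar>fst p - fst q\<bar> \<le> 1 \<and> \<bar>snd p - snd q\<bar> \<le> 1")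
  case True
  then show ?thesis using near_pair_is_box[OF assms] by metis
next
  case False
  then have "7 \<le> card (vboundary {(fst p, snd p), (fst q, snd q)})"
    by (intro card_vboundary_pair_far) linarith
  then show ?thesis by simp
qed

lemma minimal_pair_card_vboundary_le:
  assumes "minimal C" "card C = 2"
  shows "card (vboundary C) \<le> 6"
proof -
  \<comment> \<open>A box holding two points, with both ranges of length one, so that the box bound
    is 1 + 1 + 4.\<close>
  have "{(0, 0), (1, 0)} \<subseteq> box_set (-1) 0 0 1" by (simp add: mem_box_set_iff)
  then have "card {(0::int, 0::int), (1, 0)} \<le> card (box_set (-1) 0 0 1)"
    by (intro card_mono finite_box_set)
  then have "card (vboundary C) \<le> card (vboundary (box_set (-1) 0 0 1))"
    using assms by (intro minimal_card_vboundary_mono finite_box_set) simp_all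
  then show ?thesis using card_vboundary_box_le[of "-1" 0 0 1] by simp
qed

text \<open>A minimal set that is not a pair is tight. A minimal pair has at most six boundary
  points, so its points are close together and form a box.\<close>

lemma minimal_structure:
  assumes "minimal A" "A \<noteq> {}"
  shows "(Max (ucoord ` A) - Min (ucoord ` A)) + (Max (wcoord ` A) - Min (wcoord ` A)) + 4
      \<le> int (card (vboundary A))" (is ?extent)
    and "\<And>p. p \<notin> A \<Longrightarrow> has_free_quadrant A p"
proof -
  have fin: "finite A" using assms(1) by (simp add: minimal_def)
  have "?extent \<and> (\<forall>p. p \<notin> A \<longrightarrow> has_free_quadrant A p)"
  proof (cases "card A = 2")
    case False
    obtain i0 \<delta> where "i0 \<in> ucoord ` A" "\<delta> \<le> 1" "card (slice (vboundary A) i0) = \<delta>"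
      "\<And>i. i \<noteq> i0 \<Longrightarrow> int (card (slice (vboundary A) i)) = slice_drop A i0 i"
      "int (card (vboundary A)) = 2 * int (card (slice A i0)) + int (card (ucoord ` A)) + 1 + int \<delta>"
      using minimal_tight[OF assms False] by blast
    then interpret tight_set A i0 \<delta> by unfold_locales (use fin in auto)
    show ?thesis using card_vboundary_ge_extent free_quadrant_outside by blast
  next
    case True
    then obtain p q where pq: "A = {p, q}" "p \<noteq> q" by (auto simp: card_2_iff)
    have le6: "card (vboundary A) \<le> 6" by (rule minimal_pair_card_vboundary_le[OF assms(1) True])
    have "\<bar>fst p - fst q\<bar> \<le> 1" "\<bar>snd p - snd q\<bar> \<le> 1"
      using card_vboundary_pair_far[of "fst p" "fst q" "snd p" "snd q"] le6 pq by fastforce+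
    from near_pair_is_box[OF pq(2) this] obtain a b c d
      where box: "A = box_set a b c d" "b - a + (d - c) = 2" "6 \<le> card (vboundary A)"
      unfolding pq(1)[symmetric] by blast
    have "Min (ucoord ` A) \<in> ucoord ` A" "Max (ucoord ` A) \<in> ucoord ` A"
      "Min (wcoord ` A) \<in> wcoord ` A" "Max (wcoord ` A) \<in> wcoord ` A"
      using fin assms(2) by auto
    moreover have "a \<le> ucoord p \<and> ucoord p \<le> b \<and> c \<le> wcoord p \<and> wcoord p \<le> d" if "p \<in> A" for p
      using that unfolding box(1) by (simp add: mem_box_set_iff)
    ultimately have "a \<le> Min (ucoord ` A)" "Max (ucoord ` A) \<le> b" "c \<le> Min (wcoord ` A)" "Max (wcoord ` A) \<le> d"
      by (metis imageE)+
    then have ?extent using box(2,3) by linarith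
    moreover have "has_free_quadrant A r" if "r \<notin> A" for r
      using that has_free_quadrant_outside_box[of A a b c d r] box(1) by simp
    ultimately show ?thesis by blast
  qed
  then show ?extent "\<And>p. p \<notin> A \<Longrightarrow> has_free_quadrant A p" by blast+
qed

text \<open>The box bound for \<open>enc A\<close> is exactly the lower bound on the boundary of
  \<open>A\<close> in \<open>minimal_structure\<close>.\<close>

lemma card_vboundary_enc_le:
  assumes "minimal A" "A \<noteq> {}"
  shows "card (vboundary (enc A)) \<le> card (vboundary A)"
proof -
  have fin: "finite A" using assms(1) by (simp add: minimal_def)
  have "Min (ucoord ` A) \<le> Max (ucoord ` A)" "Min (wcoord ` A) \<le> Max (wcoord ` A)"
    using fin assms(2) by (auto intro!: Max_ge Min_in)
  then show ?thesis
    using card_vboundary_box_le minimal_structure(1)[OF assms]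
    unfolding enc_eq_box[OF fin assms(2)] by (meson of_nat_le_iff order_trans)
qed

section \<open>Boundary sizes of minimal sets and the excess\<close>

text \<open>By the isoperimetric inequality the boundary size bounds both the number of rows and the
  largest row. The point is finiteness: sets of given boundary size have bounded
  cardinality.\<close>

lemma card_le_card_vboundary_squared:
  assumes "finite A"
  shows "card A \<le> card (vboundary A) * card (vboundary A)"
proof (cases "A = {}")
  case False
  let ?a = "\<lambda>i. card (slice A i)"
  have "Max (?a ` ucoord ` A) \<in> ?a ` ucoord ` A"
    using assms False by (intro Max_in) auto
  then obtain i0 where i0: "i0 \<in> ucoord ` A" "?a i0 = Max (?a ` ucoord ` A)" by (metis imageE)
  have max: "?a i \<le> ?a i0" for i
  proof (cases "i \<in> ucoord ` A")
    case True
    then show ?thesis unfolding i0(2) using assms by (intro Max_ge) auto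
  next
    case False
    then have "slice A i = {}" using slice_nonempty_iff by blast
    then show ?thesis by simp
  qed
  have "2 * int (?a i0) + int (card (ucoord ` A)) + 1 \<le> int (card (vboundary A))"
    using card_vboundary_ge[OF assms i0(1), of "{}"] by simp
  then have "?a i0 \<le> card (vboundary A)" "card (ucoord ` A) \<le> card (vboundary A)" by linarith+
  then have "card (ucoord ` A) * ?a i0 \<le> card (vboundary A) * card (vboundary A)"
    by (intro mult_le_mono)
  then show ?thesis using card_le_rows(1)[OF assms max] by linarith
qed simp

lemma ex_point_uw:
  assumes "even (v - u)" shows "\<exists>p. ucoord p = u \<and> wcoord p = v"
proof -
  obtain m where "v - u = 2 * m" using assms by blast
  then show ?thesis by (intro exI[of _ "(m, m + u)"]) simp
qed

text \<open>Lengthening one range of the bounding box by one makes room for a new point and raises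
  the box bound by one. With two points in \<open>C\<close> the other range can be taken of length
  at least one, so the new side contains a lattice point. For singletons this fails: the boundary
  size jumps from 4 to 6.\<close>

lemma minimal_card_vboundary_step:
  assumes "minimal C" "2 \<le> card C" "minimal C'" "card C' = Suc (card C)"
  shows "card (vboundary C') \<le> Suc (card (vboundary C))"
proof -
  have fin: "finite C" using assms(1) by (simp add: minimal_def)
  have ne: "C \<noteq> {}" using assms(2) by auto
  define a where "a = Min (ucoord ` C)"
  define b where "b = Max (ucoord ` C)"
  define c where "c = Min (wcoord ` C)"
  define d where "d = Max (wcoord ` C)"
  have bds: "a \<le> ucoord p \<and> ucoord p \<le> b \<and> c \<le> wcoord p \<and> wcoord p \<le> d" if "p \<in> C" for p
    using that fin unfolding a_def b_def c_def d_def by auto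
  obtain p0 where "p0 \<in> C" using ne by blast
  then have le: "a \<le> b" "c \<le> d" using bds by fastforce+
  have ext: "(b - a) + (d - c) + 4 \<le> int (card (vboundary C))"
    using minimal_structure(1)[OF assms(1) ne] by (simp add: a_def b_def c_def d_def)
  have conclude: ?thesis
    if "a \<le> b'" "c \<le> d'" "b \<le> b'" "d \<le> d'" "(b' - a) + (d' - c) = (b - a) + (d - c) + 1"
      and r: "r \<in> box_set a b' c d'" "r \<notin> C" for b' d' r
  proof -
    have "insert r C \<subseteq> box_set a b' c d'" using bds that by (fastforce simp: mem_box_set_iff)
    then have "card (insert r C) \<le> card (box_set a b' c d')"
      by (intro card_mono finite_box_set)
    then have "card C' \<le> card (box_set a b' c d')" using r fin assms(4) by simp
    then have "card (vboundary C') \<le> card (vboundary (box_set a b' c d'))"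
      by (intro minimal_card_vboundary_mono[OF assms(3)] finite_box_set)
    then show ?thesis using card_vboundary_box_le[of a b' c d'] that ext by linarith
  qed
  show ?thesis
  proof (cases "a < b")
    case True
    \<comment> \<open>Both \<open>a\<close> and \<open>a + 1\<close> lie in the range, and one of
      them has the right parity.\<close>
    define u where "u = (if even (d + 1 - a) then a else a + 1)"
    have "even (d + 1 - u)" by (auto simp: u_def)
    then obtain r where r: "ucoord r = u" "wcoord r = d + 1" using ex_point_uw by blast
    show ?thesis
    proof (rule conclude[of b "d + 1" r])
      show "r \<in> box_set a b c (d + 1)"
        unfolding mem_box_set_iff r using True le by (auto simp: u_def)
      show "r \<notin> C" using bds[of r] r by auto
    qed (use le in auto)
  next
    case False
    then have ab: "a = b" using le by simp
    have "c \<noteq> d"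
    proof
      assume "c = d"
      then have "C \<subseteq> {p0}" using ab bds bds[OF \<open>p0 \<in> C\<close>] by (fastforce intro: uw_eqI)
      then have "card C \<le> card {p0}" by (intro card_mono) auto
      then show False using assms(2) by simp
    qed
    then have cd: "c < d" using le by simp
    define v where "v = (if even (c - (b + 1)) then c else c + 1)"
    have "even (v - (b + 1))" by (auto simp: v_def)
    then obtain r where r: "ucoord r = b + 1" "wcoord r = v" using ex_point_uw by blast
    show ?thesis
    proof (rule conclude[of "b + 1" d r])
      show "r \<in> box_set a (b + 1) c d"
        unfolding mem_box_set_iff r using cd le by (auto simp: v_def)
      show "r \<notin> C" using bds[of r] r by auto
    qed (use le in auto)
  qed
qed

text \<open>A discrete intermediate value argument: at the greatest \<open>n\<close> whose minimal
  sets have boundary size at most \<open>k\<close>, the next size exceeds \<open>k\<close>, and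
  steps have height at most one. The start is \<open>n = 2\<close> with boundary size at most
  6.\<close>

lemma ex_minimal_card_vboundary:
  assumes "6 \<le> k"
  shows "\<exists>C. minimal C \<and> card (vboundary C) = k"
proof -
  let ?P = "\<lambda>n. \<exists>C. minimal C \<and> card C = n \<and> card (vboundary C) \<le> k"
  obtain C2 where "minimal C2" "card C2 = 2" using ex_minimal_card by blast
  then have P2: "?P 2" using minimal_pair_card_vboundary_le[of C2] assms by force
  have bound: "n \<le> k * k" if "?P n" for n
  proof -
    from that obtain C where "minimal C" "card C = n" "card (vboundary C) \<le> k" by blast
    then show ?thesis
      using card_le_card_vboundary_squared[of C] mult_le_mono[of "card (vboundary C)" k "card (vboundary C)" k]
      by (simp add: minimal_def)
  qed
  define n where "n = (GREATEST n. ?P n)"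
  have "?P n" unfolding n_def using P2 bound by (rule GreatestI_nat)
  then obtain C where C: "minimal C" "card C = n" "card (vboundary C) \<le> k" by blast
  have "2 \<le> n" unfolding n_def using P2 bound by (rule Greatest_le_nat)
  obtain C' where C': "minimal C'" "card C' = Suc n" using ex_minimal_card by blast
  have "\<not> ?P (Suc n)"
  proof
    assume "?P (Suc n)"
    then have "Suc n \<le> n" unfolding n_def using bound by (rule Greatest_le_nat)
    then show False by simp
  qed
  then have "k < card (vboundary C')" using C' by fastforce
  then have "card (vboundary C) = k"
    using minimal_card_vboundary_step[OF C(1) _ C'(1)] C C' \<open>2 \<le> n\<close> by simp
  then show ?thesis using C(1) by blast
qed

text \<open>Singletons are minimal, and any larger set has at least as many boundary points as a
  pair, thus at least six.\<close>

lemma ex_minimal_same_card_vboundary: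
  assumes "finite X" "X \<noteq> {}"
  shows "\<exists>C. minimal C \<and> card (vboundary C) = card (vboundary X)"
proof (cases "card X = 1")
  case True
  have four: "card (vboundary Y) = 4" if "card Y = 1" for Y
    using that card_vboundary_singleton by (auto simp: card_1_singleton_iff)
  then have "minimal X" using True assms(1) by (simp add: minimal_def)
  then show ?thesis by blast
next
  case False
  moreover have "card X \<noteq> 0" using assms by simp
  ultimately have X2: "2 \<le> card X" by linarith
  obtain C where C: "minimal C" "card C = 2" using ex_minimal_card by blast
  then obtain p q where "C = {p, q}" "p \<noteq> q" by (auto simp: card_2_iff)
  then have "6 \<le> card (vboundary C)" using card_vboundary_pair_ge by simp
  also have "\<dots> \<le> card (vboundary X)"
    using minimal_card_vboundary_mono[OF C(1) assms(1)] C(2) X2 by simp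
  finally show ?thesis by (rule ex_minimal_card_vboundary)
qed

text \<open>The set in \<open>Exc\<close> is finite by \<open>card_le_card_vboundary_squared\<close>
  and nonempty by \<open>ex_minimal_same_card_vboundary\<close>, so \<open>Max\<close> is a true
  maximum.\<close>

lemma le_Exc_iff:
  assumes "finite X" "X \<noteq> {}"
  shows "n \<le> Exc X \<longleftrightarrow> (\<exists>C. minimal C \<and> card (vboundary C) = card (vboundary X) \<and>
    n \<le> int (card X) - int (card C))"
proof -
  let ?S = "{int (card X) - int (card C) | C. minimal C \<and> card (vboundary C) = card (vboundary X)}"
  let ?k = "card (vboundary X)"
  have "?S \<subseteq> (\<lambda>m. int (card X) - int m) ` {..?k * ?k}"
  proof
    fix t assume "t \<in> ?S"
    then obtain C where C: "t = int (card X) - int (card C)" "minimal C" "card (vboundary C) = ?k" by blast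
    then have "card C \<le> ?k * ?k" using card_le_card_vboundary_squared[of C] by (simp add: minimal_def)
    then show "t \<in> (\<lambda>m. int (card X) - int m) ` {..?k * ?k}" using C(1) by blast
  qed
  then have "finite ?S" by (rule finite_subset) simp
  moreover have "?S \<noteq> {}" using ex_minimal_same_card_vboundary[OF assms] by blast
  ultimately have "n \<le> Exc X \<longleftrightarrow> (\<exists>t\<in>?S. n \<le> t)" unfolding Exc_def by (rule Max_ge_iff)
  then show ?thesis by blast
qed

section \<open>Cones\<close>

lemma int_affine:
  fixes g :: "int \<Rightarrow> int"
  assumes "\<And>x. g (x + 1) = g x + c"
  shows "g x = g 0 + c * x"
proof (induction x rule: int_induct[of _ 0])
  case (step1 i)
  then show ?case using assms[of i] by (simp add: algebra_simps)
next
  case (step2 i)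
  then show ?case using assms[of "i - 1"] by (simp add: algebra_simps)
qed simp

lemma adj_commute: "adj p q \<longleftrightarrow> adj q p"
  by (simp add: adj_def abs_minus_commute)

text \<open>With \<open>P = f p\<close> and neighbours \<open>Q\<close>, \<open>Q'\<close> of \<open>P\<close>, the point \<open>Q + Q' - P\<close> is again a common
  neighbour of \<open>Q\<close> and \<open>Q'\<close>, so it is the image of a common neighbour of the preimages.\<close>

lemma automorphism_reflected_neighbour:
  assumes f: "graph_automorphism f" and "adj p q" "adj p q'"
  obtains z where "adj z q" "adj z q'"
    "f z = (fst (f q) + fst (f q') - fst (f p), snd (f q) + snd (f q') - snd (f p))"
proof -
  let ?z = "(fst (f q) + fst (f q') - fst (f p), snd (f q) + snd (f q') - snd (f p))"
  have "surj f" using f by (simp add: graph_automorphism_def bij_is_surj)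
  then obtain z where z: "f z = ?z" by (metis surjD)
  have "adj (f p) (f q)" "adj (f p) (f q')" using assms unfolding graph_automorphism_def by blast+
  then have "adj ?z (f q)" "adj ?z (f q')" unfolding adj_def by simp_all
  then have "adj z q" "adj z q'" using f unfolding z[symmetric] graph_automorphism_def by blast+
  then show ?thesis using z by (rule that)
qed

text \<open>Two opposite neighbours of \<open>(x, y)\<close> have no common neighbour except
  \<open>(x, y)\<close>, so the reflected point is \<open>f (x, y)\<close> itself.\<close>

lemma automorphism_line:
  assumes f: "graph_automorphism f" and "d \<in> {(1, 0), (0, 1)}"
  shows "fst (f (x + fst d, y + snd d)) + fst (f (x - fst d, y - snd d)) = 2 * fst (f (x, y))"
    and "snd (f (x + fst d, y + snd d)) + snd (f (x - fst d, y - snd d)) = 2 * snd (f (x, y))"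
proof -
  let ?q = "(x + fst d, y + snd d)" and ?q' = "(x - fst d, y - snd d)"
  have "adj (x, y) ?q" "adj (x, y) ?q'" using assms(2) by (auto simp: adj_iff)
  then obtain z where z: "adj z ?q" "adj z ?q'"
    "f z = (fst (f ?q) + fst (f ?q') - fst (f (x, y)), snd (f ?q) + snd (f ?q') - snd (f (x, y)))"
    by (rule automorphism_reflected_neighbour[OF f])
  have eqs: "fst (f z) = fst (f ?q) + fst (f ?q') - fst (f (x, y))"
    "snd (f z) = snd (f ?q) + snd (f ?q') - snd (f (x, y))"
    unfolding z(3) by simp_all
  have zxy: "z = (x, y)"
    using z(1,2) assms(2) unfolding adj_commute[of z] by (auto simp: adj_iff)
  show "fst (f ?q) + fst (f ?q') = 2 * fst (f (x, y))" "snd (f ?q) + snd (f ?q') = 2 * snd (f (x, y))"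
    using eqs unfolding zxy by linarith+
qed

text \<open>The common neighbours of \<open>?q\<close> and \<open>?q'\<close> are
  \<open>(x, y)\<close> and the opposite corner, and injectivity excludes the first.\<close>

lemma automorphism_square:
  assumes f: "graph_automorphism f"
  shows "fst (f (x + 1, y + 1)) = fst (f (x + 1, y)) + fst (f (x, y + 1)) - fst (f (x, y))"
    and "snd (f (x + 1, y + 1)) = snd (f (x + 1, y)) + snd (f (x, y + 1)) - snd (f (x, y))"
proof -
  let ?q = "(x + 1, y)" and ?q' = "(x, y + 1)"
  have "adj (x, y) ?q" "adj (x, y) ?q'" by (auto simp: adj_iff)
  then obtain z where z: "adj z ?q" "adj z ?q'"
    "f z = (fst (f ?q) + fst (f ?q') - fst (f (x, y)), snd (f ?q) + snd (f ?q') - snd (f (x, y)))"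
    by (rule automorphism_reflected_neighbour[OF f])
  have eqs: "fst (f z) = fst (f ?q) + fst (f ?q') - fst (f (x, y))"
    "snd (f z) = snd (f ?q) + snd (f ?q') - snd (f (x, y))"
    unfolding z(3) by simp_all
  have "z \<noteq> (x, y)"
  proof
    assume zxy: "z = (x, y)"
    \<comment> \<open>By \<open>automorphism_line\<close>, both sides are the reflection of
      \<open>f ?q\<close> in \<open>f (x, y)\<close>.\<close>
    have "f ?q' = f (x - 1, y)"
      using eqs automorphism_line[OF f, of "(1, 0)" x y] unfolding zxy by (intro prod_eqI) simp_all
    moreover have "inj f" using f by (simp add: graph_automorphism_def bij_is_inj)
    ultimately show False by (simp add: inj_eq)
  qed
  then have "z = (x + 1, y + 1)"
    using z(1,2) unfolding adj_commute[of z] by (auto simp: adj_iff)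
  with eqs show "fst (f (x + 1, y + 1)) = fst (f ?q) + fst (f ?q') - fst (f (x, y))"
    "snd (f (x + 1, y + 1)) = snd (f ?q) + snd (f ?q') - snd (f (x, y))"
    by simp_all
qed

text \<open>The line conditions make the differences constant along both axes, and the square
  condition makes vertical differences independent of \<open>x\<close>.\<close>

lemma affine_of_parallelograms:
  fixes g :: "int \<times> int \<Rightarrow> int"
  assumes line: "\<And>x y. g (x + 1, y) + g (x - 1, y) = 2 * g (x, y)"
    "\<And>x y. g (x, y + 1) + g (x, y - 1) = 2 * g (x, y)"
    and square: "\<And>x y. g (x + 1, y + 1) = g (x + 1, y) + g (x, y + 1) - g (x, y)"
  shows "g (x, y) = g (0, 0) + (g (1, 0) - g (0, 0)) * x + (g (0, 1) - g (0, 0)) * y"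
proof -
  have 1: "g (x + 1, 0) = g (x, 0) + (g (1, 0) - g (0, 0))" for x
    using int_affine[of "\<lambda>x. g (x + 1, 0) - g (x, 0)" 0 x] line(1)[of "_ + 1" 0]
    by (simp add: algebra_simps)
  have 2: "g (x, y + 1) - g (x, y) = g (0, y + 1) - g (0, y)" for x y
    using int_affine[of "\<lambda>x. g (x, y + 1) - g (x, y)" 0 x] square[of _ y] by simp
  have 3: "g (0, y + 1) - g (0, y) = g (0, 1) - g (0, 0)" for y
    using int_affine[of "\<lambda>y. g (0, y + 1) - g (0, y)" 0 y] line(2)[of 0 "_ + 1"]
    by (simp add: algebra_simps)
  have "g (x, y + 1) = g (x, y) + (g (0, 1) - g (0, 0))" for y
    using 2[of x y] 3[of y] by simp
  then have "g (x, y) = g (x, 0) + (g (0, 1) - g (0, 0)) * y"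
    by (rule int_affine)
  moreover have "g (x, 0) = g (0, 0) + (g (1, 0) - g (0, 0)) * x"
    using int_affine[of "\<lambda>x. g (x, 0)", OF 1] .
  ultimately show ?thesis by simp
qed

text \<open>The linear part is read off from the images of the unit vectors. Adjacency makes them
  unit vectors again, and injectivity keeps them from being equal or opposite, which leaves the
  eight symmetries of the square.\<close>

lemma automorphism_affine:
  assumes f: "graph_automorphism f"
  obtains a1 a2 b1 b2 c1 c2 where "\<forall>x y. f (x, y) = (c1 + a1 * x + b1 * y, c2 + a2 * x + b2 * y)"
    "\<bar>a1\<bar> + \<bar>a2\<bar> = 1" "\<bar>b1\<bar> + \<bar>b2\<bar> = 1" "(a1, a2) \<noteq> (b1, b2)" "(a1, a2) \<noteq> (- b1, - b2)"
proof -
  define a1 a2 b1 b2 where "a1 = fst (f (1, 0)) - fst (f (0, 0))" and "a2 = snd (f (1, 0)) - snd (f (0, 0))"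
    and "b1 = fst (f (0, 1)) - fst (f (0, 0))" and "b2 = snd (f (0, 1)) - snd (f (0, 0))"
  note ab = a1_def a2_def b1_def b2_def
  have "fst (f (x, y)) = fst (f (0, 0)) + a1 * x + b1 * y" for x y
    unfolding ab
  proof (rule affine_of_parallelograms[of "\<lambda>p. fst (f p)"])
    fix x y
    show "fst (f (x + 1, y)) + fst (f (x - 1, y)) = 2 * fst (f (x, y))"
      using automorphism_line(1)[OF f, of "(1, 0)" x y] by simp
    show "fst (f (x, y + 1)) + fst (f (x, y - 1)) = 2 * fst (f (x, y))"
      using automorphism_line(1)[OF f, of "(0, 1)" x y] by simp
  qed (rule automorphism_square(1)[OF f])
  moreover have "snd (f (x, y)) = snd (f (0, 0)) + a2 * x + b2 * y" for x y
    unfolding ab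
  proof (rule affine_of_parallelograms[of "\<lambda>p. snd (f p)"])
    fix x y
    show "snd (f (x + 1, y)) + snd (f (x - 1, y)) = 2 * snd (f (x, y))"
      using automorphism_line(2)[OF f, of "(1, 0)" x y] by simp
    show "snd (f (x, y + 1)) + snd (f (x, y - 1)) = 2 * snd (f (x, y))"
      using automorphism_line(2)[OF f, of "(0, 1)" x y] by simp
  qed (rule automorphism_square(2)[OF f])
  ultimately have coords: "fst (f (x, y)) = fst (f (0, 0)) + a1 * x + b1 * y"
    "snd (f (x, y)) = snd (f (0, 0)) + a2 * x + b2 * y" for x y by blast+
  have eq: "f (x, y) = (fst (f (0, 0)) + a1 * x + b1 * y, snd (f (0, 0)) + a2 * x + b2 * y)" for x y
    using coords[of x y] by (intro prod_eqI) simp_all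
  have "adj (f (1, 0)) (f (0, 0))" "adj (f (0, 1)) (f (0, 0))"
    using f by (simp_all add: graph_automorphism_def adj_iff)
  then have unit: "\<bar>a1\<bar> + \<bar>a2\<bar> = 1" "\<bar>b1\<bar> + \<bar>b2\<bar> = 1" unfolding ab adj_def by simp_all
  have inj: "inj f" using f by (simp add: graph_automorphism_def bij_is_inj)
  have "f (1, 0) \<noteq> f (0, 1)" "f (1, 0) \<noteq> f (0, - 1)" using inj by (simp_all add: inj_eq)
  then have "(a1, a2) \<noteq> (b1, b2)" "(a1, a2) \<noteq> (- b1, - b2)"
    using coords[of 1 0] coords[of 0 1] coords[of 0 "-1"] by (auto simp: prod_eq_iff)
  then show ?thesis using that[OF _ unit] eq by blast
qed

lemma unit_int_pair_cases:
  fixes a b :: int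
  assumes "\<bar>a\<bar> + \<bar>b\<bar> = 1"
  shows "(a, b) \<in> {(1, 0), (-1, 0), (0, 1), (0, -1)}"
  using assms by (cases "a = 0") auto

text \<open>Each symmetry of the square acts on (u, w) by signs and possibly an exchange. The signs
  give \<sigma> and \<tau>; the exchange does not affect the conjunction of both
  inequalities.\<close>

lemma automorphism_quadrant:
  assumes f: "graph_automorphism f"
  obtains \<sigma> \<tau> where "\<sigma> \<in> {1, -1}" "\<tau> \<in> {1, -1}"
    "\<forall>q r. \<sigma> * (ucoord q - ucoord r) \<ge> 0 \<and> \<tau> * (wcoord q - wcoord r) \<ge> 0 \<longrightarrow>
      ucoord (f q) \<ge> ucoord (f r) \<and> wcoord (f q) \<ge> wcoord (f r)"
proof -
  obtain a1 a2 b1 b2 c1 c2 where eq: "\<forall>x y. f (x, y) = (c1 + a1 * x + b1 * y, c2 + a2 * x + b2 * y)"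
    and "\<bar>a1\<bar> + \<bar>a2\<bar> = 1" "\<bar>b1\<bar> + \<bar>b2\<bar> = 1" and ne: "(a1, a2) \<noteq> (b1, b2)" "(a1, a2) \<noteq> (- b1, - b2)"
    by (rule automorphism_affine[OF f])
  then have "(a1, a2) \<in> {(1, 0), (-1, 0), (0, 1), (0, -1)}" "(b1, b2) \<in> {(1, 0), (-1, 0), (0, 1), (0, -1)}"
    using unit_int_pair_cases by blast+
  then consider "a1 = 1 \<and> a2 = 0 \<and> b1 = 0 \<and> b2 = 1" | "a1 = 1 \<and> a2 = 0 \<and> b1 = 0 \<and> b2 = -1"
    | "a1 = -1 \<and> a2 = 0 \<and> b1 = 0 \<and> b2 = 1" | "a1 = -1 \<and> a2 = 0 \<and> b1 = 0 \<and> b2 = -1"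
    | "a1 = 0 \<and> a2 = 1 \<and> b1 = 1 \<and> b2 = 0" | "a1 = 0 \<and> a2 = 1 \<and> b1 = -1 \<and> b2 = 0"
    | "a1 = 0 \<and> a2 = -1 \<and> b1 = 1 \<and> b2 = 0" | "a1 = 0 \<and> a2 = -1 \<and> b1 = -1 \<and> b2 = 0"
    using ne by auto
  then show ?thesis
  proof cases
    case 1 show ?thesis by (rule that[of 1 1]) (auto simp: eq 1)
  next
    case 2 show ?thesis by (rule that[of "-1" "-1"]) (auto simp: eq 2)
  next
    case 3 show ?thesis by (rule that[of 1 1]) (auto simp: eq 3)
  next
    case 4 show ?thesis by (rule that[of "-1" "-1"]) (auto simp: eq 4)
  next
    case 5 show ?thesis by (rule that[of "-1" 1]) (auto simp: eq 5)
  next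
    case 6 show ?thesis by (rule that[of "-1" 1]) (auto simp: eq 6)
  next
    case 7 show ?thesis by (rule that[of 1 "-1"]) (auto simp: eq 7)
  next
    case 8 show ?thesis by (rule that[of 1 "-1"]) (auto simp: eq 8)
  qed
qed

section \<open>Cones and quadrants\<close>

text \<open>In each case an explicit automorphism moves \<open>p\<close> to the origin and
  multiplies u by \<sigma> and w by \<tau>.\<close>

lemma quadrant_is_cone:
  assumes "\<sigma> \<in> {1, -1}" "\<tau> \<in> {1, -1}"
  shows "is_cone {q. \<sigma> * (ucoord q - ucoord p) \<ge> 0 \<and> \<tau> * (wcoord q - wcoord p) \<ge> 0}"
proof -
  obtain x0 y0 where p: "p = (x0, y0)" by (cases p)
  let ?K = "{q. \<sigma> * (ucoord q - ucoord p) \<ge> 0 \<and> \<tau> * (wcoord q - wcoord p) \<ge> 0}"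
  have cone: "is_cone ?K"
    if "bij f" "\<And>q r. adj (f q) (f r) \<longleftrightarrow> adj q r"
      "\<And>q. ucoord (f q) = \<sigma> * (ucoord q - ucoord p)" "\<And>q. wcoord (f q) = \<tau> * (wcoord q - wcoord p)" for f
  proof -
    have "?K = f -` {(x, y). y - x \<ge> 0 \<and> y + x \<ge> 0}"
    proof (rule set_eqI)
      fix q
      show "q \<in> ?K \<longleftrightarrow> q \<in> f -` {(x, y). y - x \<ge> 0 \<and> y + x \<ge> 0}"
        unfolding mem_Collect_eq that(3,4)[symmetric] by (cases "f q") (simp add: add.commute)
    qed
    then have "f ` ?K = {(x, y). y - x \<ge> 0 \<and> y + x \<ge> 0}"
      by (simp only: surj_image_vimage_eq[OF bij_is_surj[OF that(1)]])
    then show ?thesis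
      using that(1,2) unfolding is_cone_def congruent_sets_def graph_automorphism_def by blast
  qed
  consider "\<sigma> = 1 \<and> \<tau> = 1" | "\<sigma> = -1 \<and> \<tau> = -1" | "\<sigma> = 1 \<and> \<tau> = -1" | "\<sigma> = -1 \<and> \<tau> = 1"
    using assms by blast
  then show ?thesis
  proof cases
    case 1
    show ?thesis
    proof (rule cone[of "\<lambda>(x, y). (x - x0, y - y0)"])
      show "bij (\<lambda>(x, y). (x - x0, y - y0))"
        by (rule bij_betw_byWitness[of _ "\<lambda>(x, y). (x + x0, y + y0)"]) auto
    next
      fix q r
      show "adj (case q of (x, y) \<Rightarrow> (x - x0, y - y0)) (case r of (x, y) \<Rightarrow> (x - x0, y - y0)) = adj q r"
        by (simp add: adj_def split_beta abs_minus_commute add.commute)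
    qed (simp_all add: split_beta ucoord_def wcoord_def p 1)
  next
    case 2
    show ?thesis
    proof (rule cone[of "\<lambda>(x, y). (x0 - x, y0 - y)"])
      show "bij (\<lambda>(x, y). (x0 - x, y0 - y))"
        by (rule bij_betw_byWitness[of _ "\<lambda>(x, y). (x0 - x, y0 - y)"]) auto
    next
      fix q r
      show "adj (case q of (x, y) \<Rightarrow> (x0 - x, y0 - y)) (case r of (x, y) \<Rightarrow> (x0 - x, y0 - y)) = adj q r"
        by (simp add: adj_def split_beta abs_minus_commute add.commute)
    qed (simp_all add: split_beta ucoord_def wcoord_def p 2)
  next
    case 3
    show ?thesis
    proof (rule cone[of "\<lambda>(x, y). (y0 - y, x0 - x)"])
      show "bij (\<lambda>(x, y). (y0 - y, x0 - x))"
        by (rule bij_betw_byWitness[of _ "\<lambda>(x, y). (x0 - y, y0 - x)"]) auto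
    next
      fix q r
      show "adj (case q of (x, y) \<Rightarrow> (y0 - y, x0 - x)) (case r of (x, y) \<Rightarrow> (y0 - y, x0 - x)) = adj q r"
        by (simp add: adj_def split_beta abs_minus_commute add.commute)
    qed (simp_all add: split_beta ucoord_def wcoord_def p 3)
  next
    case 4
    show ?thesis
    proof (rule cone[of "\<lambda>(x, y). (y - y0, x - x0)"])
      show "bij (\<lambda>(x, y). (y - y0, x - x0))"
        by (rule bij_betw_byWitness[of _ "\<lambda>(x, y). (y + x0, x + y0)"]) auto
    next
      fix q r
      show "adj (case q of (x, y) \<Rightarrow> (y - y0, x - x0)) (case r of (x, y) \<Rightarrow> (y - y0, x - x0)) = adj q r"
        by (simp add: adj_def split_beta abs_minus_commute add.commute)
    qed (simp_all add: split_beta ucoord_def wcoord_def p 4)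
  qed
qed

text \<open>By \<open>automorphism_quadrant\<close> a cone contains, with a point \<open>p\<close>,
  a whole quadrant with apex \<open>p\<close>. Conversely a free quadrant at \<open>p\<close> is a
  cone through \<open>p\<close> in the complement.\<close>

lemma union_of_cones_iff:
  "union_of_cones (- A) \<longleftrightarrow> (\<forall>p. p \<notin> A \<longrightarrow> has_free_quadrant A p)"
proof
  assume "union_of_cones (- A)"
  then obtain F where F: "\<forall>K\<in>F. is_cone K" "- A = \<Union>F" unfolding union_of_cones_def by blast
  show "\<forall>p. p \<notin> A \<longrightarrow> has_free_quadrant A p"
  proof (intro allI impI)
    fix p assume "p \<notin> A"
    then obtain K where K: "K \<in> F" "p \<in> K" using F(2) by blast
    then have "is_cone K" using F(1) by blast
    then obtain f where f: "graph_automorphism f" and fK: "f ` K = {(x, y). y - x \<ge> 0 \<and> y + x \<ge> 0}"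
      unfolding is_cone_def congruent_sets_def by (elim exE conjE)
    have mem: "q \<in> K \<longleftrightarrow> ucoord (f q) \<ge> 0 \<and> wcoord (f q) \<ge> 0" for q
    proof -
      have "inj f" using f by (simp add: graph_automorphism_def bij_is_inj)
      then have "q \<in> K \<longleftrightarrow> f q \<in> f ` K" by (simp add: inj_image_mem_iff)
      then show ?thesis unfolding fK by (cases "f q") (simp add: add.commute)
    qed
    obtain \<sigma> \<tau> where \<sigma>\<tau>: "\<sigma> \<in> {1, -1}" "\<tau> \<in> {1, -1}"
      and mono: "\<forall>q r. \<sigma> * (ucoord q - ucoord r) \<ge> 0 \<and> \<tau> * (wcoord q - wcoord r) \<ge> 0 \<longrightarrow>
        ucoord (f q) \<ge> ucoord (f r) \<and> wcoord (f q) \<ge> wcoord (f r)"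
      by (rule automorphism_quadrant[OF f])
    have "free_quadrant A p \<sigma> \<tau>" unfolding free_quadrant_def
    proof (intro ballI impI, rule ccontr)
      fix q assume q: "q \<in> A" "\<sigma> * (ucoord q - ucoord p) \<ge> 0" "\<not> \<tau> * (wcoord q - wcoord p) < 0"
      then have "ucoord (f q) \<ge> ucoord (f p) \<and> wcoord (f q) \<ge> wcoord (f p)"
        using mono unfolding not_less by blast
      then have "q \<in> K" using mem[of p] mem[of q] K(2) by linarith
      then show False using K(1) F(2) q(1) by blast
    qed
    then show "has_free_quadrant A p" using \<sigma>\<tau> by (rule has_free_quadrantI)
  qed
next
  assume free: "\<forall>p. p \<notin> A \<longrightarrow> has_free_quadrant A p"
  let ?F = "{K. is_cone K \<and> K \<subseteq> - A}"
  have "p \<in> \<Union>?F" if "p \<notin> A" for p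
  proof -
    from free that obtain \<sigma> \<tau> where \<sigma>\<tau>: "\<sigma> \<in> {1, -1}" "\<tau> \<in> {1, -1}" "free_quadrant A p \<sigma> \<tau>"
      unfolding has_free_quadrant_def by blast
    let ?K = "{q. \<sigma> * (ucoord q - ucoord p) \<ge> 0 \<and> \<tau> * (wcoord q - wcoord p) \<ge> 0}"
    have "is_cone ?K" using \<sigma>\<tau>(1,2) by (rule quadrant_is_cone)
    moreover have "?K \<subseteq> - A"
    proof
      fix q assume q: "q \<in> ?K"
      show "q \<in> - A"
      proof
        assume "q \<in> A"
        then have "\<tau> * (wcoord q - wcoord p) < 0" using q \<sigma>\<tau>(3) unfolding free_quadrant_def by blast
        then show False using q by simp
      qed
    qed
    moreover have "p \<in> ?K" by simp
    ultimately show ?thesis by blast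
  qed
  then have "- A = \<Union>?F" by blast
  moreover have "\<forall>K\<in>?F. is_cone K" by simp
  ultimately show "union_of_cones (- A)" unfolding union_of_cones_def by (intro exI conjI)
qed

section \<open>Refilling the enclosing box\<close>

text \<open>Every side of \<open>enc A\<close> passes through a point of \<open>A\<close>, so no
  closed diagonal half-plane whose edge contains a point of the box misses \<open>A\<close>.\<close>

lemma enc_attained:
  assumes "finite A" "A \<noteq> {}" "p \<in> enc A" "\<sigma> \<in> {1, -1}"
  shows "\<exists>q\<in>A. \<sigma> * (ucoord q - ucoord p) \<ge> 0" "\<exists>q\<in>A. \<sigma> * (wcoord q - wcoord p) \<ge> 0"
proof -
  have p: "Min (ucoord ` A) \<le> ucoord p" "ucoord p \<le> Max (ucoord ` A)"
    "Min (wcoord ` A) \<le> wcoord p" "wcoord p \<le> Max (wcoord ` A)"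
    using assms(3) unfolding enc_eq_box[OF assms(1,2)] mem_box_set_iff by blast+
  have attained: "\<exists>q\<in>A. \<sigma> * (f q - f p) \<ge> 0"
    if "Min (f ` A) \<le> f p" "f p \<le> Max (f ` A)" for f :: "int \<times> int \<Rightarrow> int"
  proof -
    have "Min (f ` A) \<in> f ` A" "Max (f ` A) \<in> f ` A" using assms(1,2) by simp_all
    then obtain q1 q2 where q: "q1 \<in> A" "f q1 = Min (f ` A)" "q2 \<in> A" "f q2 = Max (f ` A)"
      by (metis imageE)
    consider "\<sigma> = 1" | "\<sigma> = -1" using assms(4) by blast
    then show ?thesis
    proof cases
      case 1
      then show ?thesis using q(3,4) that by (intro bexI[of _ q2]) simp_all
    next
      case 2
      then show ?thesis using q(1,2) that by (intro bexI[of _ q1]) simp_all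
    qed
  qed
  show "\<exists>q\<in>A. \<sigma> * (ucoord q - ucoord p) \<ge> 0" "\<exists>q\<in>A. \<sigma> * (wcoord q - wcoord p) \<ge> 0"
    using attained[of ucoord] attained[of wcoord] p by blast+
qed

lemma enc_insert:
  assumes "finite A" "A \<noteq> {}" "p \<in> enc A"
  shows "enc (insert p A) = enc A"
proof
  have fin: "finite (insert p A)" "insert p A \<noteq> {}" using assms(1) by auto
  show "enc (insert p A) \<subseteq> enc A"
    by (rule enc_least_box(3)[OF fin]) (use enc_least_box(1,2)[OF assms(1,2)] assms(3) in auto)
  show "enc A \<subseteq> enc (insert p A)"
    by (rule enc_least_box(3)[OF assms(1,2)]) (use enc_least_box(1,2)[OF fin] in auto)
qed

text \<open>The neighbour of \<open>p\<close> pointing into its free quadrant joins the boundary when \<open>p\<close> leaves it.\<close>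

lemma card_vboundary_insert_free:
  assumes "finite A" "free_quadrant A p \<sigma> \<tau>" "\<sigma> \<in> {1, -1}" "\<tau> \<in> {1, -1}"
  shows "card (vboundary A) \<le> card (vboundary (insert p A))"
proof -
  obtain r where r: "ucoord r = ucoord p + \<sigma>" "wcoord r = wcoord p + \<tau>"
  proof -
    have "even (wcoord p - ucoord p)" by (cases p) simp
    then have "even (wcoord p + \<tau> - (ucoord p + \<sigma>))" using assms(3,4) by auto
    then show ?thesis using ex_point_uw that by blast
  qed
  have sgn: "\<epsilon> * (a - b) \<ge> 0" if "\<bar>a - (b + \<epsilon>)\<bar> \<le> 1" "\<epsilon> \<in> {1, -1}" for a b \<epsilon> :: int
    using that by auto
  have near: "\<bar>ucoord q - ucoord r\<bar> \<le> 1 \<and> \<bar>wcoord q - wcoord r\<bar> \<le> 1" if "adj r q \<or> q = r" for q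
  proof -
    obtain x y where xy: "r = (x, y)" by (cases r)
    show ?thesis using that unfolding xy adj_iff by (elim disjE) simp_all
  qed
  \<comment> \<open>\<open>r\<close> and its neighbours are within one of \<open>r\<close> in both
    diagonal coordinates, hence still in the closed quadrant of \<open>p\<close>.\<close>
  have no: "q \<notin> A" if "adj r q \<or> q = r" for q
  proof
    assume "q \<in> A"
    moreover have "\<sigma> * (ucoord q - ucoord p) \<ge> 0" "\<tau> * (wcoord q - wcoord p) \<ge> 0"
      using near[OF that] assms(3,4) unfolding r by (blast intro: sgn)+
    ultimately show False using assms(2) unfolding free_quadrant_def by force
  qed
  have "adj r p"
  proof -
    obtain x y x' y' where xy: "p = (x, y)" "r = (x', y')" by (cases p; cases r)
    have xy': "2 * (x' - x) = \<tau> - \<sigma>" "2 * (y' - y) = \<sigma> + \<tau>" using r unfolding xy by simp_all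
    consider "\<sigma> = 1 \<and> \<tau> = 1" | "\<sigma> = -1 \<and> \<tau> = -1" | "\<sigma> = 1 \<and> \<tau> = -1" | "\<sigma> = -1 \<and> \<tau> = 1"
      using assms(3,4) by blast
    then show ?thesis using xy' unfolding xy adj_def by cases simp_all
  qed
  moreover have "r \<noteq> p" using r(1) assms(3) by auto
  ultimately have r1: "r \<in> vboundary (insert p A)" using no[of r] unfolding vboundary_def by blast
  have r2: "r \<notin> vboundary A" using no unfolding vboundary_def by blast
  have "vboundary A \<subseteq> insert p (vboundary (insert p A) - {r})"
    using r2 unfolding vboundary_def by blast
  then have "card (vboundary A) \<le> card (insert p (vboundary (insert p A) - {r}))"
    using finite_vboundary[of "insert p A"] assms(1) by (intro card_mono) auto
  also have "\<dots> \<le> Suc (card (vboundary (insert p A) - {r}))"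
    by (rule card_insert_le_m1) auto
  also have "\<dots> = card (vboundary (insert p A))"
    by (rule card_Suc_Diff1[OF finite_vboundary r1]) (use assms(1) in simp)
  finally show ?thesis .
qed

text \<open>Only a free quadrant of \<open>q\<close> that contains \<open>p\<close> is spoilt. Its
  direction relative to that of \<open>p\<close> then decides between a contradiction and a
  replacement.\<close>

lemma has_free_quadrant_insert:
  assumes fin: "finite A" "A \<noteq> {}"
    and p: "p \<in> enc A" "p \<notin> A" "free_quadrant A p \<sigma> \<tau>" "\<sigma> \<in> {1, -1}" "\<tau> \<in> {1, -1}"
    and min: "\<And>q. q \<in> enc A \<Longrightarrow> q \<notin> A \<Longrightarrow> free_quadrant A q \<sigma> \<tau> \<Longrightarrow>
      \<sigma> * ucoord p + \<tau> * wcoord p \<le> \<sigma> * ucoord q + \<tau> * wcoord q"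
    and q: "q \<notin> insert p A" "has_free_quadrant A q"
  shows "has_free_quadrant (insert p A) q"
proof (cases "q \<in> enc A")
  case False
  obtain a b c d where e: "enc A = box_set a b c d"
    using enc_least_box(1)[OF fin] by (auto simp: is_box_def)
  show ?thesis
    by (rule has_free_quadrant_outside_box[of _ a b c d])
      (use False enc_least_box(2)[OF fin] p(1) e in auto)
next
  case True
  from q(2) obtain \<sigma>' \<tau>' where q': "\<sigma>' \<in> {1, -1}" "\<tau>' \<in> {1, -1}" "free_quadrant A q \<sigma>' \<tau>'"
    unfolding has_free_quadrant_def by blast
  have neq: "\<not> (ucoord p = ucoord q \<and> wcoord p = wcoord q)" using q(1) uw_eqI by blast
  show ?thesis
  proof (cases "\<sigma>' * (ucoord p - ucoord q) \<ge> 0 \<and> \<tau>' * (wcoord p - wcoord q) \<ge> 0")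
    case False
    then have "free_quadrant (insert p A) q \<sigma>' \<tau>'" using q'(3) unfolding free_quadrant_def by auto
    then show ?thesis using q'(1,2) by (rule has_free_quadrantI)
  next
    case inq: True
    consider "\<sigma>' = \<sigma>" "\<tau>' = \<tau>" | "\<sigma>' = - \<sigma>" "\<tau>' = - \<tau>" | "\<sigma>' = \<sigma>" "\<tau>' = - \<tau>" | "\<sigma>' = - \<sigma>" "\<tau>' = \<tau>"
      using p(4,5) q'(1,2) by fastforce
    then show ?thesis
    proof cases
      case 1
      \<comment> \<open>Equal directions: \<open>q\<close> would come strictly before
        \<open>p\<close>, against the choice of \<open>p\<close>.\<close>
      then have "\<sigma> * ucoord p + \<tau> * wcoord p \<le> \<sigma> * ucoord q + \<tau> * wcoord q"
        using min[OF True] q'(3) q(1) by blast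
      then show ?thesis using inq neq p(4,5) unfolding 1 by auto
    next
      case 2
      \<comment> \<open>Opposite directions: \<open>q\<close> lies in the quadrant of
        \<open>p\<close>, so its own quadrant in that direction is part of it.\<close>
      have "free_quadrant (insert p A) q \<sigma> \<tau>"
        using p(3,4,5) inq neq unfolding free_quadrant_def 2 by fastforce
      then show ?thesis using p(4,5) by (rule has_free_quadrantI)
    next
      case 3
      \<comment> \<open>The two quadrants together cover the half-plane beyond \<open>p\<close> in
        direction \<sigma>, which meets \<open>A\<close> by \<open>enc_attained\<close>. The last
        case exchanges the roles of u and w.\<close>
      obtain r where r: "r \<in> A" "\<sigma> * (ucoord r - ucoord p) \<ge> 0"
        using enc_attained(1)[OF fin p(1,4)] by blast
      have "\<tau> * (wcoord r - wcoord p) < 0" using p(3) r unfolding free_quadrant_def by blast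
      moreover have "\<sigma> * (ucoord r - ucoord q) \<ge> 0" using r(2) inq p(4) unfolding 3 by auto
      then have "- \<tau> * (wcoord r - wcoord q) < 0" using q'(3) r(1) unfolding free_quadrant_def 3 by blast
      ultimately show ?thesis using inq p(5) unfolding 3 by auto
    next
      case 4
      obtain r where r: "r \<in> A" "\<tau> * (wcoord r - wcoord p) \<ge> 0"
        using enc_attained(2)[OF fin p(1,5)] by blast
      have "\<sigma> * (ucoord r - ucoord p) < 0"
        using p(3) r unfolding free_quadrant_def by (meson not_less)
      moreover have "\<tau> * (wcoord r - wcoord q) \<ge> 0" using r(2) inq p(5) unfolding 4 by auto
      then have "- \<sigma> * (ucoord r - ucoord q) < 0"
        using q'(3) r(1) unfolding free_quadrant_def 4 by (meson not_less)
      ultimately show ?thesis using inq p(4) unfolding 4 by auto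
    qed
  qed
qed

text \<open>Each added point leaves \<open>enc A\<close> unchanged, does not lower the boundary
  size, and preserves the free quadrants of the remaining outside points.\<close>

lemma card_vboundary_le_enc:
  assumes "finite A" "A \<noteq> {}" "\<And>p. p \<notin> A \<Longrightarrow> has_free_quadrant A p"
  shows "card (vboundary A) \<le> card (vboundary (enc A))"
  using assms
proof (induction "card (enc A - A)" arbitrary: A)
  case 0
  have "finite (enc A)" unfolding enc_eq_box[OF "0.prems"(1,2)] by (rule finite_box_set)
  then have "enc A - A = {}" using 0 by simp
  then have "enc A = A" using enc_least_box(2)[OF "0.prems"(1,2)] by blast
  then show ?case by simp
next
  case (Suc n)
  note fin = Suc.prems(1,2)
  have finE: "finite (enc A)" unfolding enc_eq_box[OF fin] by (rule finite_box_set)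
  have "enc A - A \<noteq> {}" using Suc.hyps(2) by (metis card.empty nat.distinct(1))
  then obtain p0 where p0: "p0 \<in> enc A" "p0 \<notin> A" by blast
  then obtain \<sigma> \<tau> where st: "\<sigma> \<in> {1, -1}" "\<tau> \<in> {1, -1}" "free_quadrant A p0 \<sigma> \<tau>"
    using Suc.prems(3) unfolding has_free_quadrant_def by blast
  let ?S = "{q \<in> enc A. q \<notin> A \<and> free_quadrant A q \<sigma> \<tau>}"
  let ?m = "\<lambda>q. \<sigma> * ucoord q + \<tau> * wcoord q"
  have "finite ?S" using finE by simp
  moreover have "?S \<noteq> {}" using p0 st(3) by blast
  \<comment> \<open>Among the candidates for one fixed direction, the least advanced one is added
    first, as \<open>has_free_quadrant_insert\<close> demands.\<close>
  ultimately obtain p where p: "p \<in> ?S" "\<forall>q\<in>?S. ?m p \<le> ?m q"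
    using ex_is_arg_min_if_finite[of ?S ?m] unfolding is_arg_min_linorder by blast
  let ?A = "insert p A"
  have fin': "finite ?A" "?A \<noteq> {}" using fin by auto
  have enc': "enc ?A = enc A" using enc_insert[OF fin] p(1) by blast
  have "card (vboundary A) \<le> card (vboundary ?A)"
    using card_vboundary_insert_free[OF fin(1) _ st(1,2)] p(1) by blast
  also have "\<dots> \<le> card (vboundary (enc ?A))"
  proof (rule Suc.hyps(1)[OF _ fin'])
    have "enc ?A - ?A = enc A - A - {p}" unfolding enc' by blast
    then show "n = card (enc ?A - ?A)" using Suc.hyps(2) p(1) finE by simp
    fix q assume "q \<notin> ?A"
    then show "has_free_quadrant ?A q"
      using has_free_quadrant_insert[OF fin, of p \<sigma> \<tau> q] p st(1,2) Suc.prems(3)[of q] by blast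
  qed
  finally show ?case unfolding enc' .
qed

section \<open>Equivalence of the three conditions\<close>

theorem theorem7p6:
  fixes A :: "(int \<times> int) set" and N :: nat and E :: int
  assumes "finite A" and "A \<noteq> {}"
    and "N = card (enc A - A)" and "E = Exc (enc A)"
  shows "(minimal A \<longleftrightarrow> card (vboundary A) = card (vboundary (enc A)) \<and> int N \<le> E)
       \<and> (minimal A \<longleftrightarrow> union_of_cones (- A) \<and> int N \<le> E)"
proof -
  note fin = assms(1,2)
  have sub: "A \<subseteq> enc A" by (rule enc_least_box(2)[OF fin])
  have finE: "finite (enc A)" unfolding enc_eq_box[OF fin] by (rule finite_box_set)
  have neE: "enc A \<noteq> {}" using sub fin(2) by blast
  have N: "int N = int (card (enc A)) - int (card A)"
    unfolding assms(3) using card_Diff_subset[OF fin(1) sub] card_mono[OF finE sub] by simp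
  \<comment> \<open>The size of \<open>enc A\<close> cancels, leaving a comparison of
    \<open>C\<close> with \<open>A\<close>.\<close>
  have excess: "int N \<le> E \<longleftrightarrow>
      (\<exists>C. minimal C \<and> card (vboundary C) = card (vboundary (enc A)) \<and> card C \<le> card A)"
    unfolding assms(4) le_Exc_iff[OF finE neE] N by simp
  have 12: "card (vboundary A) = card (vboundary (enc A)) \<and> int N \<le> E" if min: "minimal A"
  proof -
    have "card (vboundary A) = card (vboundary (enc A))"
    proof (rule antisym)
      show "card (vboundary A) \<le> card (vboundary (enc A))"
        by (rule minimal_card_vboundary_mono[OF min finE card_mono[OF finE sub]])
    qed (rule card_vboundary_enc_le[OF min fin(2)])
    then show ?thesis unfolding excess using min by blast
  qed
  have 21: "minimal A" if eq: "card (vboundary A) = card (vboundary (enc A))" and ex: "int N \<le> E"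
  proof -
    obtain C where C: "minimal C" "card (vboundary C) = card (vboundary A)" "card C \<le> card A"
      using ex unfolding excess eq by blast
    have "card (vboundary A) \<le> card (vboundary D)" if "finite D" "card D = card A" for D
      using minimal_card_vboundary_mono[OF C(1), of D] that C(2,3) by simp
    then show ?thesis using fin(1) unfolding minimal_def by blast
  qed
  have 13: "union_of_cones (- A)" if "minimal A"
    unfolding union_of_cones_iff using minimal_structure(2)[OF that fin(2)] by blast
  have 32: "card (vboundary A) = card (vboundary (enc A))" if cones: "union_of_cones (- A)" and ex: "int N \<le> E"
  proof (rule antisym)
    show "card (vboundary A) \<le> card (vboundary (enc A))"
      using card_vboundary_le_enc[OF fin] cones unfolding union_of_cones_iff by blast
    \<comment> \<open>\<open>C\<close> has the boundary size of \<open>enc A\<close> and at most as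
      many points as \<open>A\<close>, so monotonicity gives the reverse inequality.\<close>
    obtain C where "minimal C" "card (vboundary C) = card (vboundary (enc A))" "card C \<le> card A"
      using ex unfolding excess by blast
    then show "card (vboundary (enc A)) \<le> card (vboundary A)"
      using minimal_card_vboundary_mono[of C A] fin(1) by simp
  qed
  show ?thesis using 12 21 13 32 by blast
qed

end
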